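(* Let $\lambda$ be a regular uncountable cardinal and assume $\lambda^{<\lambda}=\lambda$ and $2^\lambda=\lambda^+$. Then there exists a $\leq^*$-increasing sequence $\langle p_\xi:\xi<\lambda^+\rangle\subseteq\mathbb{Q}^0_\lambda(\mathcal F^{\rm unu})$ such that (a) $\mathrm{fil}(\{p_\xi:\xi<\lambda^+\})$ is a weakly reasonable ultrafilter on $\lambda$, but (b) there is no $p\in\mathbb{Q}^0_\lambda(\mathcal F^{\rm ult})$ with $\mathrm{fil}(p)\subseteq\mathrm{fil}(\{p_\xi:\xi<\lambda^+\})$.
   Context: Triples $(\alpha,Z,F)$ are considered with $\emptyset\ne Z\subseteq\lambda$, $|Z|<\lambda$, $\alpha=\min Z$, $F$ a proper filter on $Z$. A filter $F$ on $Z$ is unultra if for every $A\in F^+$ (i.e. $A\subseteq Z$ meeting every member of $F$) there is $B\subseteq A$ with $B\in F^+$ and $A\setminus B\in F^+$. $\mathcal F^{\rm unu}$ is the set of all such triples with $F$ unultra; $\mathcal F^{\rm ult}$ is the set of all such triples with $Z$ infinite and $F$ a non-principal ultrafilter on $Z$. For a set $\mathcal F$ of such triples: $\mathbb{Q}^*_\lambda(\mathcal F)$ is the family of $r\subseteq\mathcal F$ with $|r|=\lambda$ and fewer than $\lambda$ triples of $r$ with any given first coordinate; $r$ is strongly disjoint if at most one triple of $r$ has any given first coordinate and $(\alpha_1,Z_1,F_1),(\alpha_2,Z_2,F_2)\in r$, $\alpha_1<\alpha_2$ imply $Z_1\subseteq\alpha_2$; $\mathbb{Q}^0_\lambda(\mathcal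 F)$ is the set of strongly disjoint members of $\mathbb{Q}^*_\lambda(\mathcal F)$. $\mathrm{fil}(r)=\{A\subseteq\lambda:\exists\varepsilon<\lambda\ \forall(\alpha,Z,F)\in r\ (\varepsilon\le\alpha\Rightarrow A\cap Z\in F)\}$, $r_1\le^* r_2$ iff $\mathrm{fil}(r_1)\subseteq\mathrm{fil}(r_2)$, and $\mathrm{fil}(H)=\bigcup_{r\in H}\mathrm{fil}(r)$. A uniform ultrafilter $D$ on $\lambda$ is weakly reasonable if for every non-decreasing unbounded $f:\lambda\to\lambda$ there is a club $C$ of $\lambda$ with $\bigcup\{[\delta,\delta+f(\delta)):\delta\in C\}\notin D$. *)

theory Defs
  imports Main
begin

unbundle cardinal_syntax

text \<open>
  The cardinal \<open>\<lambda>\<close> is carried by a type of class \<open>wellorder\<close>: the ordinals below \<open>\<lambda>\<close> are the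
  elements of the type, \<open>\<lambda>\<close> itself is \<open>UNIV\<close>, and the ordinal \<open>\<alpha> < \<lambda>\<close>, as a set, is \<open>{..<\<alpha>}\<close>.
  \<open>lam\<close> is the corresponding well-order relation; that \<open>\<lambda>\<close> is a cardinal (an initial ordinal)
  is the assumption \<open>card_order lam\<close>.
\<close>

definition lam :: "'a::wellorder rel" where
  "lam = {(x, y). x \<le> y}"

text \<open>The set of sequences of length less than \<open>\<lambda>\<close> with values in \<open>\<lambda>\<close>; its cardinality is
  \<open>\<lambda>\<^bsup><\<lambda>\<^esup>\<close>.\<close>

definition short_seqs :: "('a::wellorder \<rightharpoonup> 'a) set" where
  "short_seqs = {s. \<exists>\<alpha>. dom s = {..<\<alpha>}}"

text \<open>Ordinal addition below \<open>\<lambda>\<close>: \<open>ord_add \<alpha> \<beta>\<close> is the ordinal isomorphic to a copy of \<open>\<alpha>\<close>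
  followed by a copy of \<open>\<beta>\<close>. It exists (uniquely) below \<open>\<lambda>\<close> when \<open>\<lambda>\<close> is an infinite cardinal.\<close>

definition ord_seg :: "'a::wellorder \<Rightarrow> 'a rel" where
  "ord_seg \<gamma> = {(x, y). x \<le> y \<and> y < \<gamma>}"

definition ord_concat :: "'a::wellorder \<Rightarrow> 'a \<Rightarrow> ('a + 'a) rel" where
  "ord_concat \<alpha> \<beta> =
     {(Inl x, Inl y) | x y. (x, y) \<in> ord_seg \<alpha>} \<union>
     {(Inr x, Inr y) | x y. (x, y) \<in> ord_seg \<beta>} \<union>
     {(Inl x, Inr y) | x y. x < \<alpha> \<and> y < \<beta>}"

definition ord_add :: "'a::wellorder \<Rightarrow> 'a \<Rightarrow> 'a" where
  "ord_add \<alpha> \<beta> = (THE \<gamma>. ord_seg \<gamma> =o ord_concat \<alpha> \<beta>)"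

definition unbounded_in_lam :: "'a::wellorder set \<Rightarrow> bool" where
  "unbounded_in_lam C \<longleftrightarrow> (\<forall>\<alpha>. \<exists>\<beta>\<in>C. \<alpha> < \<beta>)"

text \<open>The premises on \<open>\<delta>\<close> say that \<open>\<delta>\<close> is a limit ordinal with \<open>sup (C \<inter> \<delta>) = \<delta>\<close>.\<close>

definition club :: "'a::wellorder set \<Rightarrow> bool" where
  "club C \<longleftrightarrow> unbounded_in_lam C \<and>
     (\<forall>\<delta>. {..<\<delta>} \<noteq> {} \<and> (\<forall>\<beta><\<delta>. \<exists>\<gamma>\<in>C. \<beta> < \<gamma> \<and> \<gamma> < \<delta>) \<longrightarrow> \<delta> \<in> C)"

definition proper_filter_on :: "'a set \<Rightarrow> 'a set set \<Rightarrow> bool" where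
  "proper_filter_on Z F \<longleftrightarrow>
     F \<subseteq> Pow Z \<and> Z \<in> F \<and> {} \<notin> F \<and>
     (\<forall>A\<in>F. \<forall>B\<in>F. A \<inter> B \<in> F) \<and>
     (\<forall>A\<in>F. \<forall>B. A \<subseteq> B \<and> B \<subseteq> Z \<longrightarrow> B \<in> F)"

definition positive_sets :: "'a set \<Rightarrow> 'a set set \<Rightarrow> 'a set set" where
  "positive_sets Z F = {A. A \<subseteq> Z \<and> (\<forall>B\<in>F. A \<inter> B \<noteq> {})}"

definition unultra :: "'a set \<Rightarrow> 'a set set \<Rightarrow> bool" where
  "unultra Z F \<longleftrightarrow>
     (\<forall>A\<in>positive_sets Z F. \<exists>B\<subseteq>A. B \<in> positive_sets Z F \<and> A - B \<in> positive_sets Z F)"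

definition ultrafilter_on :: "'a set \<Rightarrow> 'a set set \<Rightarrow> bool" where
  "ultrafilter_on Z F \<longleftrightarrow> proper_filter_on Z F \<and> (\<forall>A\<subseteq>Z. A \<in> F \<or> Z - A \<in> F)"

definition principal_on :: "'a set \<Rightarrow> 'a set set \<Rightarrow> bool" where
  "principal_on Z F \<longleftrightarrow> (\<exists>A\<subseteq>Z. F = {B. A \<subseteq> B \<and> B \<subseteq> Z})"

type_synonym 'a triple = "'a \<times> 'a set \<times> 'a set set"

definition triples :: "'a::wellorder triple set" where
  "triples = {(\<alpha>, Z, F).
     Z \<noteq> {} \<and> |Z| <o (lam :: 'a rel) \<and> \<alpha> = (LEAST z. z \<in> Z) \<and> proper_filter_on Z F}"

definition F_unu :: "'a::wellorder triple set" where
  "F_unu = {(\<alpha>, Z, F). (\<alpha>, Z, F) \<in> triples \<and> unultra Z F}"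

definition F_ult :: "'a::wellorder triple set" where
  "F_ult = {(\<alpha>, Z, F). (\<alpha>, Z, F) \<in> triples \<and>
     infinite Z \<and> ultrafilter_on Z F \<and> \<not> principal_on Z F}"

definition Q_star :: "'a::wellorder triple set \<Rightarrow> 'a triple set set" where
  "Q_star FF = {r. r \<subseteq> FF \<and> |r| =o (lam :: 'a rel) \<and>
     (\<forall>\<alpha>. |{t \<in> r. fst t = \<alpha>}| <o (lam :: 'a rel))}"

definition strongly_disjoint :: "'a::wellorder triple set \<Rightarrow> bool" where
  "strongly_disjoint r \<longleftrightarrow>
     (\<forall>s\<in>r. \<forall>t\<in>r. fst s = fst t \<longrightarrow> s = t) \<and>
     (\<forall>(\<alpha>1, Z1, F1)\<in>r. \<forall>(\<alpha>2, Z2, F2)\<in>r. \<alpha>1 < \<alpha>2 \<longrightarrow> Z1 \<subseteq> {..<\<alpha>2})"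

definition Q_zero :: "'a::wellorder triple set \<Rightarrow> 'a triple set set" where
  "Q_zero FF = {r \<in> Q_star FF. strongly_disjoint r}"

definition fil :: "'a::wellorder triple set \<Rightarrow> 'a set set" where
  "fil r = {A. \<exists>\<epsilon>. \<forall>(\<alpha>, Z, F)\<in>r. \<epsilon> \<le> \<alpha> \<longrightarrow> A \<inter> Z \<in> F}"

definition le_star :: "'a::wellorder triple set \<Rightarrow> 'a triple set \<Rightarrow> bool"
    (infix \<open>\<le>\<^sup>*\<close> 50) where
  "r1 \<le>\<^sup>* r2 \<longleftrightarrow> fil r1 \<subseteq> fil r2"

definition fil_family :: "'a::wellorder triple set set \<Rightarrow> 'a set set" where
  "fil_family H = (\<Union>r\<in>H. fil r)"

definition uniform_ultrafilter :: "'a::wellorder set set \<Rightarrow> bool" where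
  "uniform_ultrafilter D \<longleftrightarrow> ultrafilter_on UNIV D \<and> (\<forall>A\<in>D. |A| =o (lam :: 'a rel))"

definition weakly_reasonable :: "'a::wellorder set set \<Rightarrow> bool" where
  "weakly_reasonable D \<longleftrightarrow> uniform_ultrafilter D \<and>
     (\<forall>f :: 'a \<Rightarrow> 'a. mono f \<and> unbounded_in_lam (range f) \<longrightarrow>
        (\<exists>C. club C \<and> (\<Union>\<delta>\<in>C. {\<delta>..<ord_add \<delta> (f \<delta>)}) \<notin> D))"

end

theory Submission imports Defs begin

text \<open>
  The sequence is built by recursion of length \<open>\<lambda>\<^sup>+\<close>, meeting at each step one subset of \<open>\<lambda>\<close> to be
  decided, one function to be handled by a club, and one \<open>q\<close> of ultrafilters to be avoided
  (\<open>2\<^sup>\<lambda> = \<lambda>\<^sup>+\<close> bounds the number of tasks). Not every \<open>p\<close> of unultra filters can be extended so as to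
  avoid a given \<open>q\<close>: if each filter of \<open>p\<close> is a cobounded sum of ultrafilters from \<open>q\<close>, then
  \<open>fil q \<subseteq> fil p\<close>. Hence only filters are used that have the hereditary property \<open>avoiding\<close>: below
  every positive set there is a positive set that is null for all ultrafilters of a given strongly
  disjoint family simultaneously. Frechet filters on countable sets have it, and it is preserved by
  restriction to positive sets and by cobounded sums over strongly disjoint families. Sums
  provide upper bounds of chains of cofinality less than \<open>\<lambda>\<close>, a diagonal choice those of
  cofinality \<open>\<lambda>\<close>. In every step the triples are chosen so sparsely that a club of gaps separates them.
\<close>

text \<open>The hard point is that avoidance survives sums. Sets null for \<open>q\<close>, chosen
  summand by summand, may have a union that is large for a member of \<open>q\<close> spreading over
  infinitely many summands. Strong disjointness on both sides helps: the carriers of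
  \<open>q\<close> and those of the summands are linearly arranged. A member of \<open>q\<close>
  that reaches cofinally far leaves no room for others on a tail, and the unultra property supplies
  a half that is null for it; bounded members are dodged by using only suitable, still cofinally
  many, summands. The hypothesis on sequences of length below \<lambda> enters in the counting:
  there are only \<lambda> bounded subsets of \<lambda>, so a whole \<open>q\<close> can be coded by
  a single subset of \<lambda>.\<close>

abbreviation carrier :: "'a triple \<Rightarrow> 'a set" where
  "carrier t \<equiv> fst (snd t)"

abbreviation filt :: "'a triple \<Rightarrow> 'a set set" where
  "filt t \<equiv> snd (snd t)"

abbreviation pos :: "'a triple \<Rightarrow> 'a set set" where
  "pos t \<equiv> positive_sets (carrier t) (filt t)"

section \<open>Triples, filters and non-principal ultrafilters\<close>

lemma mem_triples_iff:
  "t \<in> triples \<longleftrightarrow> carrier t \<noteq> {} \<and> |carrier t| <o (lam :: 'a rel) \<and>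
     fst t = (LEAST z. z \<in> carrier t) \<and> proper_filter_on (carrier t) (filt t)"
  for t :: "'a::wellorder triple"
  by (cases t) (auto simp: triples_def)

lemma mem_F_unu_iff: "t \<in> F_unu \<longleftrightarrow> t \<in> triples \<and> unultra (carrier t) (filt t)"
  by (cases t) (auto simp: F_unu_def)

lemma mem_F_ult_iff:
  "t \<in> F_ult \<longleftrightarrow> t \<in> triples \<and> infinite (carrier t) \<and>
     ultrafilter_on (carrier t) (filt t) \<and> \<not> principal_on (carrier t) (filt t)"
  by (cases t) (auto simp: F_ult_def)

lemma strongly_disjoint_iff:
  "strongly_disjoint r \<longleftrightarrow>
     (\<forall>s\<in>r. \<forall>t\<in>r. fst s = fst t \<longrightarrow> s = t) \<and>
     (\<forall>s\<in>r. \<forall>t\<in>r. fst s < fst t \<longrightarrow> carrier s \<subseteq> {..<fst t})"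
  unfolding strongly_disjoint_def by force

lemma mem_fil_iff: "A \<in> fil r \<longleftrightarrow> (\<exists>\<epsilon>. \<forall>t\<in>r. \<epsilon> \<le> fst t \<longrightarrow> A \<inter> carrier t \<in> filt t)"
  unfolding fil_def by force

lemma triple_carrier_ge: "t \<in> triples \<Longrightarrow> x \<in> carrier t \<Longrightarrow> fst t \<le> x"
  by (auto simp: mem_triples_iff intro: Least_le)

lemma triple_fst_mem: "t \<in> triples \<Longrightarrow> fst t \<in> carrier t"
  unfolding mem_triples_iff by (metis LeastI_ex equals0I)

lemma strongly_disjoint_less:
  assumes "strongly_disjoint r" "r \<subseteq> triples" "s \<in> r" "t \<in> r" "fst s < fst t"
    "x \<in> carrier s" "y \<in> carrier t"
  shows "x < y"
proof -
  have "x < fst t" using assms unfolding strongly_disjoint_iff by blast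
  moreover have "fst t \<le> y" using assms triple_carrier_ge by blast
  ultimately show ?thesis by simp
qed

lemma strongly_disjoint_eq:
  assumes "strongly_disjoint r" "r \<subseteq> triples" "s \<in> r" "t \<in> r" "x \<in> carrier s" "x \<in> carrier t"
  shows "s = t"
proof -
  have "\<not> fst s < fst t" "\<not> fst t < fst s"
    using strongly_disjoint_less[OF assms(1,2)] assms(3-6) by blast+
  then show ?thesis using assms unfolding strongly_disjoint_iff by (meson neqE)
qed

lemma proper_filter_onD:
  assumes "proper_filter_on Z F"
  shows "A \<in> F \<Longrightarrow> A \<subseteq> Z" "Z \<in> F" "{} \<notin> F" "A \<in> F \<Longrightarrow> B \<in> F \<Longrightarrow> A \<inter> B \<in> F"
    "A \<in> F \<Longrightarrow> A \<subseteq> B \<Longrightarrow> B \<subseteq> Z \<Longrightarrow> B \<in> F"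
  using assms unfolding proper_filter_on_def by blast+

lemma filter_mem_mono:
  assumes "proper_filter_on Z F" "A \<inter> Z \<in> F" "A \<inter> Z \<subseteq> B" shows "B \<inter> Z \<in> F"
  by (rule proper_filter_onD(5)[OF assms(1,2)]) (use assms in auto)

lemma diff_mem_filter:
  assumes F: "proper_filter_on Z F" and A: "A \<inter> Z \<notin> positive_sets Z F"
  shows "Z - A \<in> F"
proof -
  obtain B where B: "B \<in> F" "A \<inter> Z \<inter> B = {}"
    using A unfolding positive_sets_def by blast
  have "B \<subseteq> Z - A" using B proper_filter_onD(1)[OF F B(1)] by blast
  then show ?thesis using proper_filter_onD(5)[OF F B(1)] by blast
qed

lemma carrier_mem_filt: "t \<in> triples \<Longrightarrow> carrier t \<in> filt t"
  by (simp add: mem_triples_iff proper_filter_on_def)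

lemma F_ult_sub_triples: "F_ult \<subseteq> triples"
  by (auto simp: F_ult_def)

lemma positive_mono:
  "A \<in> positive_sets Z F \<Longrightarrow> A \<subseteq> B \<Longrightarrow> B \<subseteq> Z \<Longrightarrow> B \<in> positive_sets Z F"
  unfolding positive_sets_def by blast

lemma whole_mem_positive:
  assumes "proper_filter_on Z F" shows "Z \<in> positive_sets Z F"
proof -
  have "Z \<inter> A \<noteq> {}" if "A \<in> F" for A
    using proper_filter_onD(1,3)[OF assms] that by (metis inf.absorb2)
  then show ?thesis by (simp add: positive_sets_def)
qed

text \<open>A smallest finite member would be contained in every other member, since intersecting
  with one cannot shrink it. It would then generate the filter, contrary to
  non-principality.\<close>

lemma F_ult_finite_notin:
  assumes t: "t \<in> F_ult" and "finite A"
  shows "A \<notin> filt t"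
  using assms(2)
proof (induction A rule: finite_psubset_induct)
  case (psubset A)
  have F: "proper_filter_on (carrier t) (filt t)" and np: "\<not> principal_on (carrier t) (filt t)"
    using t unfolding mem_F_ult_iff mem_triples_iff by auto
  show ?case
  proof
    assume A: "A \<in> filt t"
    have "filt t = {B. A \<subseteq> B \<and> B \<subseteq> carrier t}"
    proof (intro set_eqI iffI CollectI conjI)
      fix B assume B: "B \<in> filt t"
      then show "B \<subseteq> carrier t" using proper_filter_onD(1)[OF F] by blast
      have "A \<inter> B \<in> filt t" using A B proper_filter_onD(4)[OF F] by blast
      then show "A \<subseteq> B" using psubset.IH[of "A \<inter> B"] by blast
    next
      fix B assume "B \<in> {B. A \<subseteq> B \<and> B \<subseteq> carrier t}"
      then show "B \<in> filt t" using A proper_filter_onD(5)[OF F] by blast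
    qed
    moreover have "A \<subseteq> carrier t" using A proper_filter_onD(1)[OF F] by blast
    ultimately show False using np unfolding principal_on_def by metis
  qed
qed

lemma F_ult_diff_mem:
  assumes t: "t \<in> F_ult" and "A \<inter> carrier t \<notin> filt t"
  shows "carrier t - A \<in> filt t"
proof -
  have "carrier t - A \<inter> carrier t \<in> filt t"
    using assms Int_lower2 unfolding mem_F_ult_iff ultrafilter_on_def by metis
  moreover have "carrier t - A \<inter> carrier t = carrier t - A" by blast
  ultimately show ?thesis by simp
qed

text \<open>An ultrafilter cannot contain both of two disjoint sets. Applied to the halves of a
  split, this selects a half that is null for \<open>t\<close>.\<close>

lemma ultra_diff_mem:
  assumes "t \<in> F_ult" "A \<inter> B = {}"
  shows "carrier t - A \<in> filt t \<or> carrier t - B \<in> filt t"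
proof -
  have F: "proper_filter_on (carrier t) (filt t)" and U: "ultrafilter_on (carrier t) (filt t)"
    using assms unfolding mem_F_ult_iff mem_triples_iff by auto
  have "carrier t \<inter> A \<in> filt t \<or> carrier t - (carrier t \<inter> A) \<in> filt t"
    using U unfolding ultrafilter_on_def by blast
  moreover have "carrier t - (carrier t \<inter> A) = carrier t - A" by blast
  moreover have "carrier t \<inter> A \<subseteq> carrier t - B" using assms by blast
  ultimately show ?thesis using proper_filter_onD(5)[OF F] by (metis Diff_subset)
qed

text \<open>One \<open>B\<close> has to serve all members of \<open>q\<close> together. Both
  \<open>q\<close> and \<open>A\<close> are quantified universally: \<open>q\<close> because the
  families to be avoided come up only later in the recursion, \<open>A\<close> so that the property
  passes to restrictions.\<close>

definition avoiding :: "'a::wellorder triple \<Rightarrow> bool" where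
  "avoiding t \<longleftrightarrow> (\<forall>q A. q \<subseteq> F_ult \<and> strongly_disjoint q \<and> A \<in> pos t \<longrightarrow>
     (\<exists>B\<subseteq>A. B \<in> pos t \<and> (\<forall>s\<in>q. carrier s - B \<in> filt s)))"

lemma avoidingD:
  assumes "avoiding t" "q \<subseteq> F_ult" "strongly_disjoint q" "A \<in> pos t"
  obtains B where "B \<subseteq> A" "B \<in> pos t" "\<And>s. s \<in> q \<Longrightarrow> carrier s - B \<in> filt s"
  using assms unfolding avoiding_def by metis

definition good :: "'a::wellorder triple set" where
  "good = {t \<in> F_unu. avoiding t}"

lemma goodD:
  assumes "t \<in> good"
  shows "t \<in> triples" "proper_filter_on (carrier t) (filt t)" "unultra (carrier t) (filt t)"
    "avoiding t" "t \<in> F_unu"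
  using assms unfolding good_def mem_F_unu_iff mem_triples_iff by auto

section \<open>Filters restricted to positive sets\<close>

definition restr :: "'a::wellorder triple \<Rightarrow> 'a set \<Rightarrow> 'a triple" where
  "restr t B = (LEAST z. z \<in> B, B, (\<lambda>A. A \<inter> B) ` filt t)"

lemma restr_sel [simp]:
  "fst (restr t B) = (LEAST z. z \<in> B)" "carrier (restr t B) = B"
  "filt (restr t B) = (\<lambda>A. A \<inter> B) ` filt t"
  by (simp_all add: restr_def)

lemma pos_restr:
  assumes B: "B \<in> pos t"
  shows "pos (restr t B) = {A \<in> pos t. A \<subseteq> B}"
proof -
  have *: "A \<inter> (C \<inter> B) = A \<inter> C" if "A \<subseteq> B" for A C using that by blast
  show ?thesis using B unfolding positive_sets_def by (auto simp: *)
qed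

lemma proper_filter_restr:
  assumes F: "proper_filter_on (carrier t) (filt t)" and B: "B \<in> pos t"
  shows "proper_filter_on B (filt (restr t B))"
proof -
  have BZ: "B \<subseteq> carrier t" and ne: "\<And>A. A \<in> filt t \<Longrightarrow> B \<inter> A \<noteq> {}"
    using B unfolding positive_sets_def by auto
  have 1: "B \<in> (\<lambda>A. A \<inter> B) ` filt t"
    using BZ proper_filter_onD(2)[OF F] by (metis image_eqI inf.absorb2)
  have 2: "\<exists>D\<in>filt t. (A \<inter> B) \<inter> (C \<inter> B) = D \<inter> B" if "A \<in> filt t" "C \<in> filt t" for A C
    by (rule bexI[OF _ proper_filter_onD(4)[OF F that]]) blast
  have 3: "\<exists>D\<in>filt t. C = D \<inter> B" if "A \<in> filt t" "A \<inter> B \<subseteq> C" "C \<subseteq> B" for A C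
  proof (rule bexI)
    show "C = (A \<union> C) \<inter> B" using that by blast
    have "A \<union> C \<subseteq> carrier t" using that BZ proper_filter_onD(1)[OF F that(1)] by blast
    then show "A \<union> C \<in> filt t" using proper_filter_onD(5)[OF F that(1)] by blast
  qed
  have 4: "{} \<notin> (\<lambda>A. A \<inter> B) ` filt t" using ne by blast
  show ?thesis
    unfolding proper_filter_on_def restr_sel
  proof (intro conjI ballI allI impI)
    fix A C assume "A \<in> (\<lambda>A. A \<inter> B) ` filt t" "C \<in> (\<lambda>A. A \<inter> B) ` filt t"
    then obtain A' C' where "A' \<in> filt t" "C' \<in> filt t" "A = A' \<inter> B" "C = C' \<inter> B"
      by (elim imageE)
    then show "A \<inter> C \<in> (\<lambda>A. A \<inter> B) ` filt t" using 2[of A' C'] by (simp add: image_iff)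
  next
    fix A C assume "A \<in> (\<lambda>A. A \<inter> B) ` filt t" "A \<subseteq> C \<and> C \<subseteq> B"
    then obtain A' where "A' \<in> filt t" "A' \<inter> B \<subseteq> C" "C \<subseteq> B" by (elim imageE) simp
    then show "C \<in> (\<lambda>A. A \<inter> B) ` filt t" using 3[of A' C] by (simp add: image_iff)
  qed (use 1 4 in auto)
qed

text \<open>Unultra and avoiding only speak of positive sets below a given positive set, and by
  \<open>pos_restr\<close> the positive sets of the restriction are those of \<open>t\<close> below
  \<open>B\<close>. Hence witnesses found for \<open>t\<close> remain witnesses.\<close>

lemma good_restr:
  fixes t :: "'a::wellorder triple"
  assumes t: "t \<in> good" and B: "B \<in> pos t"
  shows "restr t B \<in> good"
proof -
  note g = goodD[OF t]
  have BZ: "B \<subseteq> carrier t" using B unfolding positive_sets_def by auto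
  have "B \<noteq> {}" using B proper_filter_onD(2)[OF g(2)] unfolding positive_sets_def by blast
  moreover have "|B| <o (lam :: 'a rel)"
    using g(1) BZ unfolding mem_triples_iff by (meson card_of_mono1 ordLeq_ordLess_trans)
  ultimately have 1: "restr t B \<in> triples"
    unfolding mem_triples_iff using proper_filter_restr[OF g(2) B] by simp
  have 2: "unultra (carrier (restr t B)) (filt (restr t B))"
    unfolding unultra_def pos_restr[OF B]
  proof
    fix A assume A: "A \<in> {A \<in> pos t. A \<subseteq> B}"
    then obtain C where "C \<subseteq> A" "C \<in> pos t" "A - C \<in> pos t"
      using g(3) unfolding unultra_def by blast
    then show "\<exists>C\<subseteq>A. C \<in> {A \<in> pos t. A \<subseteq> B} \<and> A - C \<in> {A \<in> pos t. A \<subseteq> B}"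
      using A by blast
  qed
  have 3: "avoiding (restr t B)"
    unfolding avoiding_def pos_restr[OF B]
  proof (intro allI impI, elim conjE)
    fix q :: "'a triple set" and A
    assume A: "A \<in> {A \<in> pos t. A \<subseteq> B}" and q: "q \<subseteq> F_ult" "strongly_disjoint q"
    then have "A \<in> pos t" by blast
    then obtain C where "C \<subseteq> A" "C \<in> pos t" "\<And>s. s \<in> q \<Longrightarrow> carrier s - C \<in> filt s"
      using avoidingD[OF g(4) q] by metis
    then show "\<exists>C\<subseteq>A. C \<in> {A \<in> pos t. A \<subseteq> B} \<and> (\<forall>s\<in>q. carrier s - C \<in> filt s)"
      using A by blast
  qed
  show ?thesis using 1 2 3 by (simp add: good_def mem_F_unu_iff)
qed

lemma restr_fst_ge:
  assumes "t \<in> triples" "B \<in> pos t" shows "fst t \<le> fst (restr t B)"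
proof -
  have BZ: "B \<subseteq> carrier t" using assms unfolding positive_sets_def by auto
  have "B \<noteq> {}"
    using assms proper_filter_onD(2) unfolding mem_triples_iff positive_sets_def by blast
  then have "(LEAST z. z \<in> B) \<in> B" by (metis LeastI_ex equals0I)
  then show ?thesis using triple_carrier_ge[OF assms(1)] BZ by auto
qed

text \<open>A local form of \<open>fil p \<subseteq> fil r\<close>: if almost all triples \<open>t\<close> of \<open>r\<close> satisfy \<open>finer p t\<close>, then the
  inclusion holds, and unlike the inclusion this can be diagonalised over \<open>\<lambda>\<close> many \<open>p\<close>.\<close>

definition finer :: "'a triple set \<Rightarrow> 'a triple \<Rightarrow> bool" where
  "finer p t \<longleftrightarrow> (\<forall>A. (\<forall>s\<in>p. A \<inter> carrier s \<in> filt s) \<longrightarrow> A \<inter> carrier t \<in> filt t)"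

lemma finer_self: "t \<in> p \<Longrightarrow> finer p t"
  unfolding finer_def by blast

lemma finer_restr:
  assumes "finer p t" "B \<in> pos t" shows "finer p (restr t B)"
proof -
  have "B \<subseteq> carrier t" using assms unfolding positive_sets_def by auto
  then have *: "A \<inter> B = (A \<inter> carrier t) \<inter> B" for A by blast
  show ?thesis unfolding finer_def restr_sel
    using assms(1) by (subst *) (auto simp: finer_def)
qed

section \<open>Frechet filters\<close>

lemma proper_filter_frechet:
  assumes Z: "infinite Z"
  shows "proper_filter_on Z {A. A \<subseteq> Z \<and> finite (Z - A)}"
proof -
  have "finite (Z - A \<inter> B)" if "finite (Z - A)" "finite (Z - B)" for A B
    using that by (simp add: Diff_Int)
  moreover have "finite (Z - B)" if "finite (Z - A)" "A \<subseteq> B" for A B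
    using that by (meson Diff_mono finite_subset order_refl)
  ultimately show ?thesis using Z unfolding proper_filter_on_def by auto
qed

lemma positive_frechet:
  "positive_sets Z {A. A \<subseteq> Z \<and> finite (Z - A)} = {A. A \<subseteq> Z \<and> infinite A}" if "infinite Z"
proof (intro set_eqI iffI)
  fix A assume A: "A \<in> positive_sets Z {A. A \<subseteq> Z \<and> finite (Z - A)}"
  have "infinite A"
  proof
    assume "finite A"
    then have "Z - A \<in> {A. A \<subseteq> Z \<and> finite (Z - A)}"
      by (auto intro: finite_subset[of _ A])
    then have "A \<inter> (Z - A) \<noteq> {}" using A unfolding positive_sets_def by blast
    then show False by simp
  qed
  then show "A \<in> {A. A \<subseteq> Z \<and> infinite A}" using A by (simp add: positive_sets_def)
next
  fix A assume A: "A \<in> {A. A \<subseteq> Z \<and> infinite A}"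
  have "A \<inter> B \<noteq> {}" if "finite (Z - B)" for B
  proof
    assume "A \<inter> B = {}"
    then have "A \<subseteq> Z - B" using A by blast
    then show False using A that finite_subset by blast
  qed
  then show "A \<in> positive_sets Z {A. A \<subseteq> Z \<and> finite (Z - A)}"
    using A by (auto simp: positive_sets_def)
qed

lemma infinite_split:
  assumes "infinite A"
  shows "\<exists>B\<subseteq>A. infinite B \<and> infinite (A - B)"
proof -
  obtain f :: "nat \<Rightarrow> 'a" where f: "inj f" "range f \<subseteq> A"
    using infinite_countable_subset[OF assms] by blast
  let ?B = "range (\<lambda>n. f (2 * n))" and ?C = "range (\<lambda>n. f (2 * n + 1))"
  have "inj (\<lambda>n. f (2 * n))" "inj (\<lambda>n. f (2 * n + 1))"
    by (auto intro!: injI dest: injD[OF f(1)])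
  then have "infinite ?B" "infinite ?C" using finite_imageD infinite_UNIV_nat by blast+
  moreover have "f (2 * m) \<noteq> f (2 * n + 1)" for m n
    using f(1) by (metis double_not_eq_Suc_double Suc_eq_plus1 injD)
  then have "?B \<inter> ?C = {}" by blast
  then have "?C \<subseteq> A - ?B" using f(2) by blast
  ultimately have "infinite ?B" "infinite (A - ?B)" using finite_subset by blast+
  moreover have "?B \<subseteq> A" using f(2) by blast
  ultimately show ?thesis by blast
qed

text \<open>If some \<open>s\<close> in \<open>q\<close> meets \<open>A\<close> in an infinite set,
  split that intersection into two infinite parts: one of them is null for \<open>s\<close>, and the
  other members of \<open>q\<close> do not meet it at all. Otherwise every member of
  \<open>q\<close> meets \<open>A\<close> in a finite set, and finite sets are null for
  non-principal ultrafilters.\<close>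

lemma good_frechet:
  fixes Z :: "'a::wellorder set"
  assumes Z: "infinite Z" "|Z| <o (lam :: 'a rel)"
  shows "(LEAST z. z \<in> Z, Z, {A. A \<subseteq> Z \<and> finite (Z - A)}) \<in> good" (is "?t \<in> _")
proof -
  have p: "pos ?t = {A. A \<subseteq> Z \<and> infinite A}" using positive_frechet[OF Z(1)] by simp
  have "?t \<in> triples"
    using Z proper_filter_frechet[OF Z(1)] unfolding mem_triples_iff by auto
  moreover have "unultra (carrier ?t) (filt ?t)"
    unfolding unultra_def p
  proof
    fix A assume "A \<in> {A. A \<subseteq> Z \<and> infinite A}"
    moreover from this obtain B where "B \<subseteq> A" "infinite B" "infinite (A - B)"
      using infinite_split[of A] by blast
    ultimately show "\<exists>B\<subseteq>A. B \<in> {A. A \<subseteq> Z \<and> infinite A} \<and> A - B \<in> {A. A \<subseteq> Z \<and> infinite A}"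
      by (intro exI[of _ B]) auto
  qed
  moreover have "avoiding ?t"
    unfolding avoiding_def p
  proof (intro allI impI, elim conjE)
    fix q :: "'a triple set" and A
    assume q: "q \<subseteq> F_ult" "strongly_disjoint q" and A: "A \<in> {A. A \<subseteq> Z \<and> infinite A}"
    have qt: "q \<subseteq> triples" using q F_ult_sub_triples by (meson order_trans)
    show "\<exists>B\<subseteq>A. B \<in> {A. A \<subseteq> Z \<and> infinite A} \<and> (\<forall>s\<in>q. carrier s - B \<in> filt s)"
    proof (cases "\<exists>s\<in>q. infinite (A \<inter> carrier s)")
      case True
      then obtain s where s: "s \<in> q" "infinite (A \<inter> carrier s)" by blast
      obtain B where B: "B \<subseteq> A \<inter> carrier s" "infinite B" "infinite (A \<inter> carrier s - B)"
        using infinite_split[OF s(2)] by blast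
      obtain C where C: "C \<subseteq> A \<inter> carrier s" "infinite C" "carrier s - C \<in> filt s"
        using ultra_diff_mem[of s B "A \<inter> carrier s - B"] s(1) q(1) B that by (metis Diff_disjoint
            Diff_subset subsetD)
      have "carrier r - C \<in> filt r" if r: "r \<in> q" for r
      proof (cases "r = s")
        case False
        then have "carrier r \<inter> carrier s = {}"
          using strongly_disjoint_eq[OF q(2) qt r s(1)] by blast
        then have "carrier r - C = carrier r" using C(1) by blast
        then show ?thesis using carrier_mem_filt[of r] r qt by (metis subsetD)
      qed (use C in simp)
      then show ?thesis using C A by (intro exI[of _ C]) auto
    next
      case False
      have "carrier s - A \<in> filt s" if s: "s \<in> q" for s
        using False s q(1) F_ult_finite_notin by (intro F_ult_diff_mem) blast+
      then show ?thesis using A by (intro exI[of _ A]) auto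
    qed
  qed
  ultimately show ?thesis by (simp add: good_def mem_F_unu_iff)
qed

section \<open>Cobounded sums\<close>

text \<open>This is the sum of the filters of \<open>T\<close> along the filter generated by the
  tails of \<open>T\<close>. Marking a tail by a member \<open>t0\<close> instead of an ordinal
  keeps it non-empty.\<close>

definition sum_triple :: "'a::wellorder triple set \<Rightarrow> 'a triple" where
  "sum_triple T = (LEAST z. z \<in> (\<Union>t\<in>T. carrier t), \<Union>t\<in>T. carrier t,
     {A. A \<subseteq> (\<Union>t\<in>T. carrier t) \<and>
       (\<exists>t0\<in>T. \<forall>t\<in>T. fst t0 \<le> fst t \<longrightarrow> A \<inter> carrier t \<in> filt t)})"

locale good_sum =
  fixes T :: "'a::wellorder triple set"
  assumes T_good: "T \<subseteq> good" and T_sd: "strongly_disjoint T" and T_ne: "T \<noteq> {}"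
    and T_nomax: "t \<in> T \<Longrightarrow> \<exists>t'\<in>T. fst t < fst t'"
    and T_small: "|\<Union>t\<in>T. carrier t| <o (lam :: 'a rel)"
begin

definition "U = (\<Union>t\<in>T. carrier t)"

definition "tail t0 A \<longleftrightarrow> (\<forall>t\<in>T. fst t0 \<le> fst t \<longrightarrow> A \<inter> carrier t \<in> filt t)"

lemma T_triples: "T \<subseteq> triples" using T_good goodD(1) by blast

lemma T_proper: "t \<in> T \<Longrightarrow> proper_filter_on (carrier t) (filt t)"
  using T_good goodD(2) by blast

lemma carrier_sub_U: "t \<in> T \<Longrightarrow> carrier t \<subseteq> U"
  by (auto simp: U_def)

lemma sel [simp]:
  "fst (sum_triple T) = (LEAST z. z \<in> U)" "carrier (sum_triple T) = U"
  by (simp_all add: sum_triple_def U_def)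

lemma mem_filt_sum: "A \<in> filt (sum_triple T) \<longleftrightarrow> A \<subseteq> U \<and> (\<exists>t0\<in>T. tail t0 A)"
  by (simp add: sum_triple_def U_def tail_def)

lemma tail_mono:
  assumes "tail t0 A" "fst t0 \<le> fst t1" "A \<subseteq> B" shows "tail t1 B"
  unfolding tail_def
proof (intro ballI impI)
  fix t assume t: "t \<in> T" "fst t1 \<le> fst t"
  then have "A \<inter> carrier t \<in> filt t" using assms(1,2) unfolding tail_def by (meson order_trans)
  then show "B \<inter> carrier t \<in> filt t"
    by (rule filter_mem_mono[OF T_proper[OF t(1)]]) (use assms(3) in blast)
qed

lemma tail_Int:
  assumes "tail t0 A" "tail t0 B" shows "tail t0 (A \<inter> B)"
  unfolding tail_def
proof (intro ballI impI)
  fix t assume t: "t \<in> T" "fst t0 \<le> fst t"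
  have "A \<inter> carrier t \<in> filt t" "B \<inter> carrier t \<in> filt t"
    using assms t unfolding tail_def by auto
  then have "A \<inter> carrier t \<inter> (B \<inter> carrier t) \<in> filt t"
    by (rule proper_filter_onD(4)[OF T_proper[OF t(1)]])
  moreover have "A \<inter> carrier t \<inter> (B \<inter> carrier t) = A \<inter> B \<inter> carrier t" by blast
  ultimately show "A \<inter> B \<inter> carrier t \<in> filt t" by simp
qed

lemma T_ub: "s \<in> T \<Longrightarrow> t \<in> T \<Longrightarrow> \<exists>u\<in>T. fst s \<le> fst u \<and> fst t \<le> fst u"
  by (meson linear order_refl)

lemma Int_UN:
  assumes t: "t \<in> I" "I \<subseteq> T" and B: "\<And>t. t \<in> I \<Longrightarrow> B t \<subseteq> carrier t"
  shows "(\<Union>t\<in>I. B t) \<inter> carrier t = B t"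
proof (intro equalityI subsetI)
  fix x assume "x \<in> (\<Union>t\<in>I. B t) \<inter> carrier t"
  then obtain u where u: "u \<in> I" "x \<in> B u" "x \<in> carrier t" by blast
  then have "u = t"
    using strongly_disjoint_eq[OF T_sd T_triples, of u t x] t B by (meson subsetD)
  then show "x \<in> B t" using u by simp
qed (use t B in blast)

lemma proper_sum: "proper_filter_on U (filt (sum_triple T))"
  unfolding proper_filter_on_def
proof (intro conjI ballI allI impI)
  show "filt (sum_triple T) \<subseteq> Pow U" by (auto simp: mem_filt_sum)
  have "U \<inter> carrier t = carrier t" if "t \<in> T" for t using carrier_sub_U[OF that] by blast
  then have "tail t0 U" for t0
    unfolding tail_def using proper_filter_onD(2)[OF T_proper] by simp
  then show "U \<in> filt (sum_triple T)" unfolding mem_filt_sum using T_ne by blast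
  have "\<not> tail t {}" if "t \<in> T" for t
    unfolding tail_def using proper_filter_onD(3)[OF T_proper[OF that]] that by auto
  then show "{} \<notin> filt (sum_triple T)" unfolding mem_filt_sum by blast
next
  fix A B assume "A \<in> filt (sum_triple T)" "B \<in> filt (sum_triple T)"
  then obtain s t where st: "s \<in> T" "t \<in> T" "A \<subseteq> U" "tail s A" "tail t B"
    unfolding mem_filt_sum by blast
  obtain u where u: "u \<in> T" "fst s \<le> fst u" "fst t \<le> fst u" using T_ub[OF st(1,2)] by blast
  have "tail u (A \<inter> B)"
    by (rule tail_Int) (rule tail_mono[OF st(4) u(2)] tail_mono[OF st(5) u(3)], simp)+
  then show "A \<inter> B \<in> filt (sum_triple T)" unfolding mem_filt_sum using u(1) st(3) by blast
next
  fix A B assume "A \<in> filt (sum_triple T)" "A \<subseteq> B \<and> B \<subseteq> U"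
  then show "B \<in> filt (sum_triple T)" unfolding mem_filt_sum using tail_mono by blast
qed

text \<open>If the trace of \<open>A\<close> were non-positive on a whole tail, the complement of
  \<open>A\<close> would be large there and so belong to the filter. The criterion permits building
  positive sets one summand at a time.\<close>

lemma pos_sum_iff:
  "A \<in> pos (sum_triple T) \<longleftrightarrow>
     A \<subseteq> U \<and> (\<forall>t0\<in>T. \<exists>t\<in>T. fst t0 \<le> fst t \<and> A \<inter> carrier t \<in> pos t)" (is "_ \<longleftrightarrow> ?R")
proof
  assume A: "A \<in> pos (sum_triple T)"
  have AU: "A \<subseteq> U" using A by (simp add: positive_sets_def)
  have "\<exists>t\<in>T. fst t0 \<le> fst t \<and> A \<inter> carrier t \<in> pos t" if t0: "t0 \<in> T" for t0
  proof (rule ccontr)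
    assume *: "\<not> ?thesis"
    have "(U - A) \<inter> carrier t \<in> filt t" if "t \<in> T" "fst t0 \<le> fst t" for t
    proof -
      have "A \<inter> carrier t \<notin> pos t" using * that by blast
      then have "carrier t - A \<in> filt t" by (rule diff_mem_filter[OF T_proper[OF that(1)]])
      moreover have "(U - A) \<inter> carrier t = carrier t - A" using carrier_sub_U[OF that(1)] by blast
      ultimately show ?thesis by simp
    qed
    then have "tail t0 (U - A)" unfolding tail_def by blast
    then have "U - A \<in> filt (sum_triple T)" using t0 unfolding mem_filt_sum by blast
    then have "A \<inter> (U - A) \<noteq> {}" using A unfolding positive_sets_def by blast
    then show False by blast
  qed
  then show ?R using AU by blast
next
  assume R: ?R
  have "A \<inter> C \<noteq> {}" if C: "C \<in> filt (sum_triple T)" for C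
  proof -
    obtain t0 where t0: "t0 \<in> T" "tail t0 C" using C unfolding mem_filt_sum by blast
    then obtain t where t: "t \<in> T" "fst t0 \<le> fst t" "A \<inter> carrier t \<in> pos t" using R by blast
    have "C \<inter> carrier t \<in> filt t" using t0(2) t(1,2) unfolding tail_def by blast
    then have "(A \<inter> carrier t) \<inter> (C \<inter> carrier t) \<noteq> {}"
      using t(3) unfolding positive_sets_def by blast
    then show ?thesis by blast
  qed
  then show "A \<in> pos (sum_triple T)" using R unfolding positive_sets_def sel(2) by blast
qed

lemma pos_sum_UN:
  assumes "I \<subseteq> T" "\<And>t0. t0 \<in> T \<Longrightarrow> \<exists>t\<in>I. fst t0 \<le> fst t" "\<And>t. t \<in> I \<Longrightarrow> B t \<in> pos t"
  shows "(\<Union>t\<in>I. B t) \<in> pos (sum_triple T)"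
proof -
  have B: "B t \<subseteq> carrier t" if "t \<in> I" for t using assms(3)[OF that] by (simp add: positive_sets_def)
  have "(\<Union>t\<in>I. B t) \<subseteq> U" using B assms(1) carrier_sub_U by blast
  moreover have "\<exists>t\<in>T. fst t0 \<le> fst t \<and> (\<Union>t\<in>I. B t) \<inter> carrier t \<in> pos t" if "t0 \<in> T" for t0
  proof -
    obtain t where t: "t \<in> I" "fst t0 \<le> fst t" using assms(2)[OF \<open>t0 \<in> T\<close>] by blast
    then show ?thesis using Int_UN[OF t(1) assms(1) B] assms(1,3) by (intro bexI[of _ t]) auto
  qed
  ultimately show ?thesis unfolding pos_sum_iff by blast
qed

text \<open>The summands on which \<open>A\<close> is positive are cofinal. Splitting
  \<open>A\<close> inside each of them and collecting the halves separately leaves both collections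
  positive on the same cofinal set.\<close>

lemma unultra_sum: "unultra U (filt (sum_triple T))"
  unfolding unultra_def
proof
  fix A assume A0: "A \<in> positive_sets U (filt (sum_triple T))"
  then have A: "A \<in> pos (sum_triple T)" by simp
  define I where "I = {t \<in> T. A \<inter> carrier t \<in> pos t}"
  have "\<exists>B\<subseteq>A \<inter> carrier t. B \<in> pos t \<and> A \<inter> carrier t - B \<in> pos t" if "t \<in> I" for t
  proof -
    have "unultra (carrier t) (filt t)" "A \<inter> carrier t \<in> pos t"
      using that T_good goodD(3)[of t] unfolding I_def by blast+
    then show ?thesis unfolding unultra_def by blast
  qed
  then obtain B where B: "\<And>t. t \<in> I \<Longrightarrow> B t \<subseteq> A \<inter> carrier t" "\<And>t. t \<in> I \<Longrightarrow> B t \<in> pos t"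
    "\<And>t. t \<in> I \<Longrightarrow> A \<inter> carrier t - B t \<in> pos t" by metis
  have I: "I \<subseteq> T" "\<And>t0. t0 \<in> T \<Longrightarrow> \<exists>t\<in>I. fst t0 \<le> fst t"
    using A unfolding pos_sum_iff I_def by blast+
  have 1: "(\<Union>t\<in>I. B t) \<in> pos (sum_triple T)" by (rule pos_sum_UN[OF I B(2)])
  have 2: "(\<Union>t\<in>I. A \<inter> carrier t - B t) \<in> pos (sum_triple T)" by (rule pos_sum_UN[OF I B(3)])
  have 3: "(\<Union>t\<in>I. B t) \<inter> carrier t = B t" if "t \<in> I" for t
    by (rule Int_UN[OF that I(1)]) (use B(1) in blast)
  have "(\<Union>t\<in>I. A \<inter> carrier t - B t) \<subseteq> A - (\<Union>t\<in>I. B t)" using 3 by blast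
  then have "A - (\<Union>t\<in>I. B t) \<in> pos (sum_triple T)"
    by (rule positive_mono[OF 2]) (use A in \<open>auto simp: positive_sets_def\<close>)
  then show "\<exists>B\<subseteq>A. B \<in> positive_sets U (filt (sum_triple T)) \<and>
      A - B \<in> positive_sets U (filt (sum_triple T))"
    using 1 B(1) by (intro exI[of _ "\<Union>t\<in>I. B t"]) auto
qed

text \<open>A member of \<open>q\<close> that meets cofinally many summands is the only one to meet a tail of the sum.\<close>

lemma avoiding_sum_concentrated:
  assumes q: "q \<subseteq> F_ult" "strongly_disjoint q" and A: "A \<in> pos (sum_triple T)"
    and s: "s \<in> q" and meets: "\<And>t0. t0 \<in> T \<Longrightarrow> \<exists>t\<in>T. fst t0 < fst t \<and> carrier s \<inter> carrier t \<noteq> {}"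
  shows "\<exists>B\<subseteq>A. B \<in> pos (sum_triple T) \<and> (\<forall>s\<in>q. carrier s - B \<in> filt s)"
proof -
  have qt: "q \<subseteq> triples" using q F_ult_sub_triples by (meson order_trans)
  \<comment> \<open>\<open>A\<close> itself may be large for \<open>s\<close>, but of two disjoint
    positive halves at least one is null for \<open>s\<close>.\<close>
  obtain B where B: "B \<subseteq> A" "B \<in> pos (sum_triple T)" "A - B \<in> pos (sum_triple T)"
    using unultra_sum A unfolding unultra_def sel(2) by blast
  obtain C where C: "C \<subseteq> A" "C \<in> pos (sum_triple T)" "carrier s - C \<in> filt s"
    using ultra_diff_mem[of s B "A - B"] s q(1) B that by (metis Diff_disjoint Diff_subset subsetD)
  obtain t1 x where t1: "t1 \<in> T" "x \<in> carrier s" "x \<in> carrier t1" using meets T_ne by blast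
  \<comment> \<open>Discarding the summands up to \<open>t1\<close>, which contains a point
    \<open>x\<close> of \<open>s\<close>, leaves only points above \<open>x\<close>; by
    \<open>meets\<close>, each of them is also below a further point of \<open>s\<close>.\<close>
  define D where "D = C \<inter> (\<Union>t\<in>{t\<in>T. fst t1 < fst t}. carrier t)"
  have D: "D \<in> pos (sum_triple T)"
    unfolding pos_sum_iff
  proof (intro conjI ballI)
    fix t0 assume t0: "t0 \<in> T"
    obtain t2 where t2: "t2 \<in> T" "fst t0 \<le> fst t2" "fst t1 < fst t2"
      using T_ub[OF t0 t1(1)] T_nomax by (meson less_imp_le order_le_less_trans order_trans)
    obtain t where t: "t \<in> T" "fst t2 \<le> fst t" "C \<inter> carrier t \<in> pos t"
      using C(2) t2(1) unfolding pos_sum_iff by blast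
    have "D \<inter> carrier t = C \<inter> carrier t" using t t2 unfolding D_def by auto
    then show "\<exists>t\<in>T. fst t0 \<le> fst t \<and> D \<inter> carrier t \<in> pos t"
      using t order_trans[OF t2(2) t(2)] by (intro bexI[OF _ t(1)] conjI) simp_all
  qed (auto simp: D_def U_def)
  have "carrier r - D \<in> filt r" if r: "r \<in> q" for r
  proof (cases "r = s")
    case True
    have "proper_filter_on (carrier s) (filt s)" using s qt mem_triples_iff by blast
    moreover have "carrier s - C \<subseteq> carrier s - D" unfolding D_def by blast
    ultimately show ?thesis using C(3) True proper_filter_onD(5) by blast
  next
    case False
    have "y \<notin> D" if y: "y \<in> carrier r" for y
    proof
      assume "y \<in> D"
      then obtain t where t: "t \<in> T" "fst t1 < fst t" "y \<in> carrier t" unfolding D_def by blast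
      then have xy: "x < y" using strongly_disjoint_less[OF T_sd T_triples t1(1)] t1(3) by blast
      obtain t' z where z: "t' \<in> T" "fst t < fst t'" "z \<in> carrier s" "z \<in> carrier t'"
        using meets[OF t(1)] by blast
      have yz: "y < z" using strongly_disjoint_less[OF T_sd T_triples t(1) z(1,2) t(3) z(4)] .
      \<comment> \<open>Now \<open>y\<close> lies strictly between the points \<open>x\<close> and
        \<open>z\<close> of \<open>s\<close>, whereas of two distinct members of \<open>q\<close>
        one has its carrier entirely below that of the other.\<close>
      have "fst r < fst s \<or> fst s < fst r"
        using False q(2) r s unfolding strongly_disjoint_iff by (meson neqE)
      then show False
        using strongly_disjoint_less[OF q(2) qt r s _ y t1(2)]
          strongly_disjoint_less[OF q(2) qt s r _ z(3) y] xy yz by auto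
    qed
    then have "carrier r - D = carrier r" by blast
    then show ?thesis using carrier_mem_filt[of r] r qt by (metis subsetD)
  qed
  moreover have "D \<subseteq> A" using C(1) unfolding D_def by blast
  ultimately show ?thesis using D by blast
qed

text \<open>A union of null sets, one from each summand used, is null for \<open>s\<close> as soon
  as \<open>s\<close> meets at most one of these summands. So the task is to find cofinally many
  summands, with \<open>A\<close> positive on them, that achieve this for all \<open>s\<close> in
  \<open>q\<close> at once.\<close>

lemma avoiding_sum_scattered:
  assumes q: "q \<subseteq> F_ult" "strongly_disjoint q" and A: "A \<in> pos (sum_triple T)"
    and bdd: "\<And>s. s \<in> q \<Longrightarrow> \<exists>t0\<in>T. \<forall>t\<in>T. fst t0 < fst t \<longrightarrow> carrier s \<inter> carrier t = {}"
  shows "\<exists>B\<subseteq>A. B \<in> pos (sum_triple T) \<and> (\<forall>s\<in>q. carrier s - B \<in> filt s)"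
proof -
  have qt: "q \<subseteq> triples" using q F_ult_sub_triples by (meson order_trans)
  define TA where "TA = {t \<in> T. A \<inter> carrier t \<in> pos t}"
  txt \<open>By the two linear orders, at most one member of \<open>q\<close> links triples below a given one to triples
    above it, and it is bounded. So a maximal unlinked set of triples is cofinal.\<close>
  define link where "link t t' \<longleftrightarrow>
    (\<exists>s\<in>q. carrier s \<inter> carrier t \<noteq> {} \<and> carrier s \<inter> carrier t' \<noteq> {})" for t t'
  define \<A> where "\<A> = {I. I \<subseteq> TA \<and> (\<forall>t\<in>I. \<forall>t'\<in>I. t \<noteq> t' \<longrightarrow> \<not> link t t')}"
  have "\<exists>I\<in>\<A>. \<forall>X\<in>\<A>. I \<subseteq> X \<longrightarrow> X = I"
  proof (rule subset_Zorn')
    fix C assume C: "subset.chain \<A> C"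
    have "\<not> link t t'" if t: "t \<in> X" "X \<in> C" "t' \<in> Y" "Y \<in> C" "t \<noteq> t'" for t t' X Y
    proof -
      have "X \<subseteq> Y \<or> Y \<subseteq> X" using C that unfolding subset_chain_def by blast
      then show ?thesis using C that unfolding subset_chain_def \<A>_def by blast
    qed
    moreover have "\<Union>C \<subseteq> TA" using C unfolding \<A>_def subset_chain_def by blast
    ultimately have "\<Union>C \<subseteq> TA \<and> (\<forall>t\<in>\<Union>C. \<forall>t'\<in>\<Union>C. t \<noteq> t' \<longrightarrow> \<not> link t t')"
      by (meson UnionE)
    then show "\<Union>C \<in> \<A>" unfolding \<A>_def by (rule CollectI)
  qed
  then obtain I where I: "I \<in> \<A>" and max: "\<And>X. X \<in> \<A> \<Longrightarrow> I \<subseteq> X \<Longrightarrow> X = I" by blast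
  have IT: "I \<subseteq> TA" "I \<subseteq> T" using I unfolding \<A>_def TA_def by auto
  have TA: "\<exists>t\<in>TA. fst t0 \<le> fst t" if "t0 \<in> T" for t0
    using A that unfolding pos_sum_iff TA_def by blast
  have linked: "\<exists>i\<in>I. link i t" if t: "t \<in> TA" "t \<notin> I" for t
  proof (rule ccontr)
    assume "\<not> ?thesis"
    moreover have "link i t \<longleftrightarrow> link t i" for i unfolding link_def by blast
    ultimately have "\<not> link t i" "\<not> link i t" if "i \<in> I" for i using that by blast+
    then have "insert t I \<in> \<A>" using I t(1) unfolding \<A>_def by blast
    then show False using max t(2) by blast
  qed
  have cof: "\<exists>t\<in>I. fst t0 \<le> fst t" if t0: "t0 \<in> T" for t0
  proof (rule ccontr)
    assume "\<not> ?thesis"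
    then have below: "fst t < fst t0" if "t \<in> I" for t using that not_le by blast
    obtain u where u: "u \<in> TA" "fst t0 \<le> fst u" using TA[OF t0] by blast
    have uT: "u \<in> T" using u by (simp add: TA_def)
    have "u \<notin> I" using below[of u] u(2) by auto
    then obtain i s x y where i: "i \<in> I" "s \<in> q" "x \<in> carrier s" "x \<in> carrier i"
      "y \<in> carrier s" "y \<in> carrier u"
      using linked[OF u(1)] unfolding link_def by blast
    \<comment> \<open>\<open>s\<close> does not reach beyond \<open>b\<close>, so a summand
      \<open>v\<close> above both \<open>b\<close> and \<open>u\<close> has to be linked to
      \<open>I\<close> by a different member \<open>r\<close>.\<close>
    obtain b where b: "b \<in> T" "\<And>t. t \<in> T \<Longrightarrow> fst b < fst t \<Longrightarrow> carrier s \<inter> carrier t = {}"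
      using bdd[OF i(2)] by blast
    obtain c where c: "c \<in> T" "fst b \<le> fst c" "fst u \<le> fst c" using T_ub[OF b(1) uT] by blast
    obtain c' where c': "c' \<in> T" "fst c < fst c'" using T_nomax[OF c(1)] by blast
    obtain v where v: "v \<in> TA" "fst c' \<le> fst v" using TA[OF c'(1)] by blast
    have vT: "v \<in> T" using v by (simp add: TA_def)
    have uv: "fst u < fst v" "fst b < fst v" using c c' v by auto
    have "v \<notin> I" using below[of v] u(2) uv by auto
    then obtain j r x' y' where j: "j \<in> I" "r \<in> q" "x' \<in> carrier r" "x' \<in> carrier j"
      "y' \<in> carrier r" "y' \<in> carrier v"
      using linked[OF v(1)] unfolding link_def by blast
    \<comment> \<open>Both \<open>s\<close> and \<open>r\<close> have a point in a summand below
      \<open>t0\<close> and a point in a summand not below it, so neither carrier can lie entirely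
      below the other.\<close>
    have "r \<noteq> s" using b(2)[OF vT uv(2)] j by blast
    then have "fst r < fst s \<or> fst s < fst r"
      using q(2) j(2) i(2) unfolding strongly_disjoint_iff by (meson neqE)
    moreover have "x < y'"
      using strongly_disjoint_less[OF T_sd T_triples _ vT _ i(4) j(6)] i(1) IT below uv u(2)
      by (meson order_less_trans order_less_le_trans subsetD)
    moreover have "x' < y"
      using strongly_disjoint_less[OF T_sd T_triples _ uT _ j(4) i(6)] j(1) IT below u(2)
      by (meson order_less_le_trans subsetD)
    ultimately show False
      using strongly_disjoint_less[OF q(2) qt j(2) i(2) _ j(5) i(3)]
        strongly_disjoint_less[OF q(2) qt i(2) j(2) _ i(5) j(3)] by auto
  qed
  have "\<exists>B\<subseteq>A \<inter> carrier t. B \<in> pos t \<and> (\<forall>s\<in>q. carrier s - B \<in> filt s)" if "t \<in> I" for t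
  proof -
    have "avoiding t" "A \<inter> carrier t \<in> pos t"
      using that IT T_good goodD(4)[of t] unfolding TA_def by blast+
    then show ?thesis using avoidingD[OF _ q] by metis
  qed
  then obtain B where B: "\<And>t. t \<in> I \<Longrightarrow> B t \<subseteq> A \<inter> carrier t" "\<And>t. t \<in> I \<Longrightarrow> B t \<in> pos t"
    "\<And>t s. t \<in> I \<Longrightarrow> s \<in> q \<Longrightarrow> carrier s - B t \<in> filt s" by metis
  have "carrier s - (\<Union>t\<in>I. B t) \<in> filt s" if s: "s \<in> q" for s
  proof (cases "\<exists>t\<in>I. carrier s \<inter> carrier t \<noteq> {}")
    case True
    then obtain t where t: "t \<in> I" "carrier s \<inter> carrier t \<noteq> {}" by blast
    have "carrier s \<inter> carrier t' = {}" if "t' \<in> I" "t' \<noteq> t" for t'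
      using I that t s unfolding \<A>_def link_def by blast
    then have "carrier s - (\<Union>t\<in>I. B t) = carrier s - B t" using t(1) B(1) by blast
    then show ?thesis using B(3)[OF t(1) s] by simp
  next
    case False
    then have "carrier s - (\<Union>t\<in>I. B t) = carrier s" using B(1) by blast
    then show ?thesis using carrier_mem_filt[of s] s qt by (metis subsetD)
  qed
  moreover have "(\<Union>t\<in>I. B t) \<subseteq> A" using B(1) by blast
  ultimately show ?thesis using pos_sum_UN[OF IT(2) cof B(2)] by blast
qed

lemma good_sum: "sum_triple T \<in> good"
proof -
  have "U \<noteq> {}" using T_ne T_triples triple_fst_mem carrier_sub_U by blast
  then have "sum_triple T \<in> triples"
    using T_small proper_sum unfolding mem_triples_iff by (simp add: U_def)
  moreover have "avoiding (sum_triple T)"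
    unfolding avoiding_def
  proof (intro allI impI, elim conjE)
    fix q :: "'a triple set" and A
    assume q: "q \<subseteq> F_ult" "strongly_disjoint q" "A \<in> pos (sum_triple T)"
    show "\<exists>B\<subseteq>A. B \<in> pos (sum_triple T) \<and> (\<forall>s\<in>q. carrier s - B \<in> filt s)"
    proof (cases "\<exists>s\<in>q. \<forall>t0\<in>T. \<exists>t\<in>T. fst t0 < fst t \<and> carrier s \<inter> carrier t \<noteq> {}")
      case True
      then show ?thesis using avoiding_sum_concentrated[OF q] by blast
    next
      case False
      then show ?thesis by (intro avoiding_sum_scattered[OF q]) blast
    qed
  qed
  ultimately show ?thesis using unultra_sum by (simp add: good_def mem_F_unu_iff)
qed

end

section \<open>Strongly disjoint sets of good triples\<close>

text \<open>The invariant of the recursion. Unbounded first coordinates take the place of size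
  \<lambda>, which follows from them by regularity, see \<open>goodQ_mem_Q_zero\<close>.\<close>

definition goodQ :: "'a::wellorder triple set \<Rightarrow> bool" where
  "goodQ p \<longleftrightarrow> p \<subseteq> good \<and> strongly_disjoint p \<and> (\<forall>\<beta>. \<exists>t\<in>p. \<beta> < fst t)"

text \<open>The threshold \<open>\<epsilon>\<close> does not depend on a set \<open>A\<close>,
  unlike the bounds hidden in \<open>fil p \<subseteq> fil r\<close>. Fewer than \<lambda> such
  thresholds therefore have a common bound.\<close>

definition evfiner :: "'a::wellorder triple set \<Rightarrow> 'a triple set \<Rightarrow> bool" where
  "evfiner p r \<longleftrightarrow> (\<exists>\<epsilon>. \<forall>t\<in>r. \<epsilon> \<le> fst t \<longrightarrow> finer p t)"

lemma goodQD:
  assumes "goodQ p"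
  shows "p \<subseteq> good" "strongly_disjoint p" "\<And>\<beta>. \<exists>t\<in>p. \<beta> < fst t" "p \<subseteq> triples"
proof -
  show "p \<subseteq> good" "strongly_disjoint p" "\<And>\<beta>. \<exists>t\<in>p. \<beta> < fst t"
    using assms unfolding goodQ_def by blast+
  then show "p \<subseteq> triples" using goodD(1) by (meson subsetD subsetI)
qed

text \<open>\<open>finer p t\<close> needs information about all \<open>s\<close> in
  \<open>p\<close>, while \<open>A \<in> fil p\<close> only concerns those with
  \<open>\<epsilon> \<le> fst s\<close>. Enlarging \<open>A\<close> by an initial segment covers the
  carriers of the remaining \<open>s\<close> and changes nothing on a \<open>t\<close> that starts
  after it. That \<open>b\<close> depends on \<open>\<epsilon>\<close> alone is what
  \<open>evfiner_trans\<close> uses.\<close>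

lemma finer_eventually:
  assumes p: "goodQ p"
  obtains b where "\<And>t A. t \<in> triples \<Longrightarrow> b \<le> fst t \<Longrightarrow> finer p t \<Longrightarrow>
    (\<And>s. s \<in> p \<Longrightarrow> \<epsilon> \<le> fst s \<Longrightarrow> A \<inter> carrier s \<in> filt s) \<Longrightarrow> A \<inter> carrier t \<in> filt t"
proof -
  note p' = goodQD[OF p]
  obtain u where u: "u \<in> p" "\<epsilon> < fst u" using p'(3) by blast
  have "A \<inter> carrier t \<in> filt t"
    if t: "t \<in> triples" "fst u \<le> fst t" "finer p t"
      and A: "\<And>s. s \<in> p \<Longrightarrow> \<epsilon> \<le> fst s \<Longrightarrow> A \<inter> carrier s \<in> filt s" for t A
  proof -
    have "(A \<union> {..<fst u}) \<inter> carrier s \<in> filt s" if s: "s \<in> p" for s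
    proof (cases "\<epsilon> \<le> fst s")
      case True
      have "proper_filter_on (carrier s) (filt s)" using s p'(4) mem_triples_iff by blast
      then show ?thesis by (rule filter_mem_mono[OF _ A[OF s True]]) blast
    next
      case False
      then have "fst s < fst u" using u(2) by simp
      then have "carrier s \<subseteq> {..<fst u}"
        using p'(2) s u(1) unfolding strongly_disjoint_iff by blast
      then have "(A \<union> {..<fst u}) \<inter> carrier s = carrier s" by blast
      moreover have "carrier s \<in> filt s" using carrier_mem_filt s p'(4) by blast
      ultimately show ?thesis by simp
    qed
    then have "(A \<union> {..<fst u}) \<inter> carrier t \<in> filt t" using t(3) unfolding finer_def by blast
    moreover have "x \<notin> {..<fst u}" if "x \<in> carrier t" for x
      using triple_carrier_ge[OF t(1) that] t(2) by simp
    then have "(A \<union> {..<fst u}) \<inter> carrier t = A \<inter> carrier t" by blast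
    ultimately show ?thesis by simp
  qed
  then show ?thesis using that by blast
qed

lemma evfiner_refl: "evfiner p p"
  unfolding evfiner_def using finer_self by blast

lemma evfiner_fil_mono:
  assumes p: "goodQ p" and r: "r \<subseteq> triples" and e: "evfiner p r"
  shows "fil p \<subseteq> fil r"
proof
  fix A assume "A \<in> fil p"
  then obtain \<epsilon> where \<epsilon>: "\<And>s. s \<in> p \<Longrightarrow> \<epsilon> \<le> fst s \<Longrightarrow> A \<inter> carrier s \<in> filt s"
    unfolding mem_fil_iff by blast
  obtain b where b: "\<And>t A. t \<in> triples \<Longrightarrow> b \<le> fst t \<Longrightarrow> finer p t \<Longrightarrow>
    (\<And>s. s \<in> p \<Longrightarrow> \<epsilon> \<le> fst s \<Longrightarrow> A \<inter> carrier s \<in> filt s) \<Longrightarrow> A \<inter> carrier t \<in> filt t"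
    using finer_eventually[OF p, of \<epsilon>] by metis
  obtain c where c: "\<And>t. t \<in> r \<Longrightarrow> c \<le> fst t \<Longrightarrow> finer p t" using e unfolding evfiner_def by blast
  have "A \<inter> carrier t \<in> filt t" if t: "t \<in> r" "max b c \<le> fst t" for t
  proof (rule b)
    show "t \<in> triples" using t(1) r by blast
    show "b \<le> fst t" "finer p t" using t c[OF t(1)] by simp_all
  qed (rule \<epsilon>)
  then show "A \<in> fil r" unfolding mem_fil_iff by blast
qed

lemma evfiner_trans:
  assumes p: "evfiner p r" and r: "goodQ r" and u: "u \<subseteq> triples" "evfiner r u"
  shows "evfiner p u"
proof -
  obtain \<epsilon> where \<epsilon>: "\<And>s. s \<in> r \<Longrightarrow> \<epsilon> \<le> fst s \<Longrightarrow> finer p s" using p unfolding evfiner_def by blast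
  obtain b where b: "\<And>t A. t \<in> triples \<Longrightarrow> b \<le> fst t \<Longrightarrow> finer r t \<Longrightarrow>
    (\<And>s. s \<in> r \<Longrightarrow> \<epsilon> \<le> fst s \<Longrightarrow> A \<inter> carrier s \<in> filt s) \<Longrightarrow> A \<inter> carrier t \<in> filt t"
    using finer_eventually[OF r, of \<epsilon>] by metis
  obtain c where c: "\<And>t. t \<in> u \<Longrightarrow> c \<le> fst t \<Longrightarrow> finer r t" using u(2) unfolding evfiner_def by blast
  have "finer p t" if t: "t \<in> u" "max b c \<le> fst t" for t
    unfolding finer_def
  proof (intro allI impI)
    fix A assume A: "\<forall>s\<in>p. A \<inter> carrier s \<in> filt s"
    show "A \<inter> carrier t \<in> filt t"
    proof (rule b)
      show "t \<in> triples" using t(1) u(1) by blast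
      show "b \<le> fst t" "finer r t" using t c[OF t(1)] by simp_all
      show "A \<inter> carrier s \<in> filt s" if "s \<in> r" "\<epsilon> \<le> fst s" for s
        using \<epsilon>[OF that] A unfolding finer_def by blast
    qed
  qed
  then show ?thesis unfolding evfiner_def by blast
qed

section \<open>Regularity of \<lambda> and sequences of triples of length \<lambda>\<close>

lemma lam_iff: "(x, y) \<in> lam \<longleftrightarrow> x \<le> y"
  by (simp add: lam_def)

locale regular_lam =
  fixes ty :: "'a::wellorder itself"
  assumes card: "card_order (lam :: 'a rel)" and unc: "natLeq <o (lam :: 'a rel)"
    and reg: "regularCard (lam :: 'a rel)"
begin

lemma Field_lam: "Field (lam :: 'a rel) = UNIV"
  using card card_order_on_Card_order by blast

lemma Card_lam: "Card_order (lam :: 'a rel)"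
  using card Field_lam by simp

lemma lam_ordIso: "(lam :: 'a rel) =o |UNIV :: 'a set|"
  using card card_of_unique by blast

lemma infinite_UNIV: "infinite (UNIV :: 'a set)"
  using infinite_iff_natLeq_ordLeq[of "UNIV :: 'a set"]
    ordLeq_ordIso_trans[OF ordLess_imp_ordLeq[OF unc] lam_ordIso] by simp

lemma ex_greater: "\<exists>b. (a :: 'a) < b"
  using infinite_Card_order_limit[OF Card_lam, of a] infinite_UNIV
  unfolding Field_lam lam_iff by (metis UNIV_I order_le_imp_less_or_eq)

text \<open>By regularity a cofinal set has size \<lambda>, so a small set is bounded; conversely,
  proper initial segments of a cardinal are small. Size estimates thus become statements about
  bounds.\<close>

lemma small_iff_bounded: "|X| <o (lam :: 'a rel) \<longleftrightarrow> (\<exists>b. X \<subseteq> {..<b})" for X :: "'a set"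
proof
  assume X: "|X| <o (lam :: 'a rel)"
  have "\<not> cofinal X (lam :: 'a rel)"
    using reg X Field_lam not_ordLess_ordIso unfolding regularCard_def by blast
  then obtain a where a: "\<And>x. x \<in> X \<Longrightarrow> x \<le> a"
    unfolding cofinal_def lam_iff by (metis linear)
  obtain b where "a < b" using ex_greater by blast
  then have "X \<subseteq> {..<b}" using a by fastforce
  then show "\<exists>b. X \<subseteq> {..<b}" by blast
next
  assume "\<exists>b. X \<subseteq> {..<b}"
  then obtain b where b: "X \<subseteq> {..<b}" by blast
  have "underS (lam :: 'a rel) b = {..<b}" unfolding underS_def lam_def by auto
  then have "|{..<b}| <o (lam :: 'a rel)" using card_of_underS[OF Card_lam, of b] Field_lam by simp
  then show "|X| <o (lam :: 'a rel)" using card_of_mono1[OF b] ordLeq_ordLess_trans by blast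
qed

lemma small_image_bounded:
  fixes f :: "'i \<Rightarrow> 'a"
  assumes "|I| <o (lam :: 'a rel)"
  obtains b where "\<And>i. i \<in> I \<Longrightarrow> f i < b"
proof -
  have "|f ` I| <o (lam :: 'a rel)" using assms card_of_image ordLeq_ordLess_trans by blast
  then obtain b where "f ` I \<subseteq> {..<b}" using small_iff_bounded by blast
  then show ?thesis using that by blast
qed

lemma small_Union_bounded:
  fixes X :: "'i \<Rightarrow> 'a set"
  assumes I: "|I| <o (lam :: 'a rel)" and X: "\<And>i. i \<in> I \<Longrightarrow> |X i| <o (lam :: 'a rel)"
  shows "\<exists>b. \<forall>i\<in>I. X i \<subseteq> {..<b}"
proof -
  have "\<forall>i\<in>I. \<exists>b. X i \<subseteq> {..<b}" using X small_iff_bounded by blast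
  then obtain f where f: "\<And>i. i \<in> I \<Longrightarrow> X i \<subseteq> {..<f i}" by metis
  obtain b where "\<And>i. i \<in> I \<Longrightarrow> f i < b" using small_image_bounded[OF I] by blast
  then have "X i \<subseteq> {..<b}" if "i \<in> I" for i using f[OF that] that by fastforce
  then show ?thesis by blast
qed

lemma small_segment: "|{..<b :: 'a}| <o (lam :: 'a rel)"
  using small_iff_bounded by blast

definition increasing :: "('a \<Rightarrow> 'a triple) \<Rightarrow> bool" where
  "increasing t \<longleftrightarrow> (\<forall>\<gamma>. t \<gamma> \<in> triples) \<and> (\<forall>\<gamma>' \<gamma>. \<gamma>' < \<gamma> \<longrightarrow> carrier (t \<gamma>') \<subseteq> {..<fst (t \<gamma>)})"

lemma increasing_fst_less: "increasing t \<Longrightarrow> \<gamma>' < \<gamma> \<Longrightarrow> fst (t \<gamma>') < fst (t \<gamma>)"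
  using triple_fst_mem[of "t \<gamma>'"] unfolding increasing_def by (meson lessThan_iff subsetD)

lemma increasing_fst_less_iff: "increasing t \<Longrightarrow> fst (t \<gamma>') < fst (t \<gamma>) \<longleftrightarrow> \<gamma>' < \<gamma>"
  by (metis increasing_fst_less less_asym neqE)

lemma increasing_fst_ge: "increasing t \<Longrightarrow> \<gamma> \<le> fst (t \<gamma>)"
proof (induction \<gamma> rule: less_induct)
  case (less \<gamma>)
  show ?case
  proof (rule ccontr)
    assume "\<not> ?thesis"
    then have *: "fst (t \<gamma>) < \<gamma>" by simp
    then have "fst (t (fst (t \<gamma>))) < fst (t \<gamma>)" by (rule increasing_fst_less[OF less.prems])
    then show False using less.IH[OF * less.prems] by simp
  qed
qed

lemma goodQ_range:
  assumes t: "increasing t" and good: "\<And>\<gamma>. t \<gamma> \<in> good"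
  shows "goodQ (range t)"
  unfolding goodQ_def
proof (intro conjI allI)
  show "range t \<subseteq> good" using good by blast
  have "t \<gamma>' = t \<gamma>" if "fst (t \<gamma>') = fst (t \<gamma>)" for \<gamma> \<gamma>'
    using that increasing_fst_less[OF t] by (metis less_irrefl neqE)
  moreover have "carrier (t \<gamma>') \<subseteq> {..<fst (t \<gamma>)}" if "fst (t \<gamma>') < fst (t \<gamma>)" for \<gamma> \<gamma>'
    using that increasing_fst_less_iff[OF t] t unfolding increasing_def by blast
  ultimately show "strongly_disjoint (range t)" unfolding strongly_disjoint_iff by blast
next
  fix \<beta> :: 'a
  obtain \<gamma> where "\<beta> < \<gamma>" using ex_greater by blast
  then have "\<beta> < fst (t \<gamma>)" using increasing_fst_ge[OF t, of \<gamma>] by simp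
  then show "\<exists>s\<in>range t. \<beta> < fst s" by blast
qed

lemma evfiner_range:
  assumes t: "increasing t" and "\<And>\<gamma>. \<gamma>0 \<le> \<gamma> \<Longrightarrow> finer p (t \<gamma>)"
  shows "evfiner p (range t)"
  unfolding evfiner_def
proof (intro exI ballI impI)
  fix s assume "s \<in> range t" "fst (t \<gamma>0) \<le> fst s"
  then obtain \<gamma> where "s = t \<gamma>" "\<not> fst (t \<gamma>) < fst (t \<gamma>0)" by (metis imageE not_le)
  then show "finer p s" using assms(2) increasing_fst_less_iff[OF t] by (simp add: not_less)
qed

text \<open>The points \<open>gap t \<gamma>\<close> form a club when \<open>t\<close> is increasing.\<close>

definition gap :: "('a \<Rightarrow> 'a triple) \<Rightarrow> 'a \<Rightarrow> 'a" where
  "gap t \<gamma> = (LEAST x. \<forall>\<gamma>'<\<gamma>. carrier (t \<gamma>') \<subseteq> {..<x})"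

lemma gap_bound:
  assumes "\<And>\<gamma>. t \<gamma> \<in> triples" "\<gamma>' < \<gamma>"
  shows "carrier (t \<gamma>') \<subseteq> {..<gap t \<gamma>}"
proof -
  have "|carrier (t \<gamma>')| <o (lam :: 'a rel)" for \<gamma>' using assms(1) mem_triples_iff by blast
  then have "\<exists>b. \<forall>\<gamma>'\<in>{..<\<gamma>}. carrier (t \<gamma>') \<subseteq> {..<b}"
    by (rule small_Union_bounded[OF small_segment])
  then obtain b where "\<forall>\<gamma>'\<in>{..<\<gamma>}. carrier (t \<gamma>') \<subseteq> {..<b}" ..
  then have "\<forall>\<gamma>'<\<gamma>. carrier (t \<gamma>') \<subseteq> {..<b}" by simp
  then have "\<forall>\<gamma>'<\<gamma>. carrier (t \<gamma>') \<subseteq> {..<gap t \<gamma>}" unfolding gap_def by (rule LeastI)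
  then show ?thesis using assms(2) by blast
qed

lemma gap_le: "(\<And>\<gamma>'. \<gamma>' < \<gamma> \<Longrightarrow> carrier (t \<gamma>') \<subseteq> {..<x}) \<Longrightarrow> gap t \<gamma> \<le> x"
  unfolding gap_def by (rule Least_le) blast

text \<open>By recursion, \<open>t \<gamma>\<close> is taken from \<open>S \<gamma>\<close> beyond
  all earlier carriers and beyond the value of \<open>h\<close> at the gap behind them. A varying
  \<open>S\<close> gives the diagonal choice for long chains; \<open>h\<close> leaves room for the
  intervals of a club or for the reach of a family \<open>q\<close>.\<close>

lemma thinning:
  fixes S :: "'a \<Rightarrow> 'a triple set" and h :: "'a \<Rightarrow> 'a"
  assumes S: "\<And>\<gamma>. S \<gamma> \<subseteq> triples" "\<And>\<gamma> \<beta>. \<exists>t\<in>S \<gamma>. \<beta> < fst t"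
  obtains t where "increasing t" "\<And>\<gamma>. t \<gamma> \<in> S \<gamma>" "\<And>\<gamma>. gap t \<gamma> \<le> fst (t \<gamma>)"
    "\<And>\<gamma>. h (gap t \<gamma>) \<le> fst (t \<gamma>)"
proof -
  have "\<exists>t. \<forall>\<gamma>. t \<gamma> \<in> S \<gamma> \<and> gap t \<gamma> \<le> fst (t \<gamma>) \<and> h (gap t \<gamma>) \<le> fst (t \<gamma>)"
  proof (rule dependent_wf_choice[OF wf, where
        P = "\<lambda>f \<gamma> r. r \<in> S \<gamma> \<and> gap f \<gamma> \<le> fst r \<and> h (gap f \<gamma>) \<le> fst r"])
    fix f g :: "'a \<Rightarrow> 'a triple" and \<gamma> r
    assume "\<And>z. (z, \<gamma>) \<in> {(x, y). x < y} \<Longrightarrow> f z = g z"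
    then have "gap f \<gamma> = gap g \<gamma>" unfolding gap_def by simp
    then show "(r \<in> S \<gamma> \<and> gap f \<gamma> \<le> fst r \<and> h (gap f \<gamma>) \<le> fst r) =
      (r \<in> S \<gamma> \<and> gap g \<gamma> \<le> fst r \<and> h (gap g \<gamma>) \<le> fst r)" by simp
  next
    fix \<gamma> and f :: "'a \<Rightarrow> 'a triple"
    obtain r where "r \<in> S \<gamma>" "max (gap f \<gamma>) (h (gap f \<gamma>)) < fst r" using S(2) by blast
    then show "\<exists>r. r \<in> S \<gamma> \<and> gap f \<gamma> \<le> fst r \<and> h (gap f \<gamma>) \<le> fst r"
      by (intro exI[of _ r]) (simp add: less_imp_le)
  qed
  then obtain t where t: "\<And>\<gamma>. t \<gamma> \<in> S \<gamma>" "\<And>\<gamma>. gap t \<gamma> \<le> fst (t \<gamma>)"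
    "\<And>\<gamma>. h (gap t \<gamma>) \<le> fst (t \<gamma>)" by blast
  have tt: "t \<gamma> \<in> triples" for \<gamma> using t(1) S(1) by blast
  have "carrier (t \<gamma>') \<subseteq> {..<fst (t \<gamma>)}" if "\<gamma>' < \<gamma>" for \<gamma>' \<gamma>
    using gap_bound[OF tt that] t(2)[of \<gamma>] by (meson lessThan_subset_iff order_trans)
  then have "increasing t" using tt unfolding increasing_def by blast
  then show ?thesis using that t by blast
qed

section \<open>Upper bounds of chains\<close>

text \<open>Uncountability makes a countably infinite set small enough to carry a triple, namely its
  Frechet filter. This is what starts the recursion.\<close>

lemma good_above: "\<exists>t\<in>good. (\<beta> :: 'a) < fst t"
proof -
  have "infinite {\<beta><..}"
  proof
    assume fin: "finite {\<beta><..}"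
    obtain c where c: "\<beta> < c" using ex_greater by blast
    have "Max {\<beta><..} \<in> {\<beta><..}" using fin c by (intro Max_in) auto
    moreover obtain d where d: "Max {\<beta><..} < d" using ex_greater by blast
    ultimately have "d \<in> {\<beta><..}" by auto
    then show False using Max_ge[OF fin, of d] d by simp
  qed
  then obtain f :: "nat \<Rightarrow> 'a" where f: "inj f" "range f \<subseteq> {\<beta><..}"
    using infinite_countable_subset by blast
  define Z where "Z = range f"
  have Z: "infinite Z" using f(1) unfolding Z_def using finite_imageD infinite_UNIV_nat by blast
  have "|Z| \<le>o |UNIV :: nat set|" unfolding Z_def by (rule card_of_image)
  moreover have "|UNIV :: nat set| =o natLeq" by (rule card_of_nat)
  ultimately have "|Z| \<le>o natLeq" by (rule ordLeq_ordIso_trans)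
  then have "|Z| <o (lam :: 'a rel)" using unc by (rule ordLeq_ordLess_trans)
  from good_frechet[OF Z this] obtain F where F: "(LEAST z. z \<in> Z, Z, F) \<in> good" by blast
  have "(LEAST z. z \<in> Z) \<in> Z" using Z by (metis LeastI_ex finite.emptyI equals0I)
  then have "\<beta> < (LEAST z. z \<in> Z)" using f(2) unfolding Z_def by blast
  then show ?thesis using F by (intro bexI[OF _ F]) simp
qed

text \<open>Pick from each \<open>p i\<close> a triple that is finer than all earlier
  \<open>p j\<close> and starts beyond the carriers picked before, and take the cobounded sum. From
  \<open>t i\<close> on every summand is finer than \<open>p i\<close>, and the sum only looks at
  tails.\<close>

lemma sum_common_finer:
  fixes p :: "'i \<Rightarrow> 'a triple set" and R :: "'i rel"
  assumes wo: "Well_order R" and X: "X \<subseteq> Field R" "X \<noteq> {}" "|X| <o (lam :: 'a rel)"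
    and nomax: "\<And>i. i \<in> X \<Longrightarrow> \<exists>j\<in>X. (j, i) \<notin> R"
    and p: "\<And>i. i \<in> X \<Longrightarrow> p i \<subseteq> good"
    and step: "\<And>i \<beta>. i \<in> X \<Longrightarrow> \<exists>t\<in>p i. \<beta> < fst t \<and> (\<forall>j\<in>X. (j, i) \<in> R \<longrightarrow> finer (p j) t)"
  shows "\<exists>t\<in>good. \<beta> < fst t \<and> (\<forall>i\<in>X. finer (p i) t)"
proof -
  let ?P = "\<lambda>f i r. i \<in> X \<longrightarrow> r \<in> p i \<and> \<beta> < fst r \<and> (\<forall>j\<in>X. (j, i) \<in> R \<longrightarrow> finer (p j) r) \<and>
    (\<forall>j\<in>X. (j, i) \<in> R - Id \<longrightarrow> carrier (f j) \<subseteq> {..<fst r})"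
  have "wf (R - Id)" using wo unfolding well_order_on_def by blast
  then have "\<exists>t. \<forall>i. ?P t i (t i)"
  proof (rule dependent_wf_choice[where P = ?P])
    fix f g :: "'i \<Rightarrow> 'a triple" and i and r :: "'a triple"
    assume "\<And>z. (z, i) \<in> R - Id \<Longrightarrow> f z = g z"
    then have "(\<forall>j\<in>X. (j, i) \<in> R - Id \<longrightarrow> carrier (f j) \<subseteq> {..<fst r}) =
      (\<forall>j\<in>X. (j, i) \<in> R - Id \<longrightarrow> carrier (g j) \<subseteq> {..<fst r})" by (metis (no_types))
    then show "?P f i r = ?P g i r" by argo
  next
    fix i and f :: "'i \<Rightarrow> 'a triple" assume IH: "\<And>j. (j, i) \<in> R - Id \<Longrightarrow> ?P f j (f j)"
    let ?J = "{j \<in> X. (j, i) \<in> R - Id}"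
    have "?J \<subseteq> X" by blast
    then have J: "|?J| <o (lam :: 'a rel)" using card_of_mono1 ordLeq_ordLess_trans X(3) by blast
    have small: "|carrier (f j)| <o (lam :: 'a rel)" if "j \<in> ?J" for j
    proof -
      have "f j \<in> p j" "p j \<subseteq> good" using that IH p by blast+
      then have "f j \<in> triples" using goodD(1) by blast
      then show ?thesis using mem_triples_iff by blast
    qed
    obtain b where b: "\<forall>j\<in>?J. carrier (f j) \<subseteq> {..<b}"
      using small_Union_bounded[OF J small] ..
    show "\<exists>r. ?P f i r"
    proof (cases "i \<in> X")
      case True
      obtain r where r: "r \<in> p i" "max b \<beta> < fst r" "\<forall>j\<in>X. (j, i) \<in> R \<longrightarrow> finer (p j) r"
        using step[OF True] by blast
      have "{..<b} \<subseteq> {..<fst r}" using r(2) by auto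
      then have 1: "\<forall>j\<in>X. (j, i) \<in> R - Id \<longrightarrow> carrier (f j) \<subseteq> {..<fst r}"
        using b by (metis (mono_tags, lifting) mem_Collect_eq order_trans)
      have 2: "\<beta> < fst r" using r(2) by simp
      show ?thesis by (intro exI[of _ r] impI conjI) (rule r(1) 2 r(3) 1)+
    qed blast
  qed
  then obtain t where "\<forall>i. ?P t i (t i)" ..
  then have t: "t i \<in> p i" "\<beta> < fst (t i)" "\<And>j. j \<in> X \<Longrightarrow> (j, i) \<in> R \<Longrightarrow> finer (p j) (t i)"
    and below': "\<And>j. j \<in> X \<Longrightarrow> (j, i) \<in> R - Id \<Longrightarrow> carrier (t j) \<subseteq> {..<fst (t i)}"
    if "i \<in> X" for i using that by meson+
  have good: "t i \<in> good" if "i \<in> X" for i using t(1)[OF that] p[OF that] by blast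
  have triple: "t i \<in> triples" if "i \<in> X" for i using goodD(1)[OF good[OF that]] .
  have below: "carrier (t j) \<subseteq> {..<fst (t i)}" if "i \<in> X" "j \<in> X" "(j, i) \<in> R" "j \<noteq> i" for i j
    using below'[OF that(1,2)] that by blast
  have less: "fst (t j) < fst (t i)" if "i \<in> X" "j \<in> X" "(j, i) \<in> R" "j \<noteq> i" for i j
    using below[OF that] triple_fst_mem[OF triple[OF that(2)]] by blast
  have total: "(i, j) \<in> R \<or> (j, i) \<in> R" if "i \<in> X" "j \<in> X" for i j
    using wo_rel.TOTALS[of R] wo X(1) that unfolding wo_rel_def by blast
  \<comment> \<open>First coordinates grow along \<open>R\<close>, so comparing them recovers
    \<open>R\<close> on \<open>X\<close>; tails of the sum thereby become final segments of the
    chain.\<close>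
  have le_imp: "(i, j) \<in> R" if "i \<in> X" "j \<in> X" "fst (t i) \<le> fst (t j)" for i j
    using that less[OF that(1,2)] total[OF that(1,2)] by (metis not_le)
  have small: "|\<Union>s\<in>t ` X. carrier s| <o (lam :: 'a rel)"
  proof -
    have *: "|carrier (t i)| <o (lam :: 'a rel)" if "i \<in> X" for i
      using triple[OF that] mem_triples_iff by blast
    obtain b where "\<forall>i\<in>X. carrier (t i) \<subseteq> {..<b}"
      using small_Union_bounded[OF X(3) *] ..
    then have "(\<Union>s\<in>t ` X. carrier s) \<subseteq> {..<b}" by blast
    then show ?thesis using small_iff_bounded by blast
  qed
  interpret S: good_sum "t ` X"
  proof
    show "t ` X \<subseteq> good" using good by blast
    have "t i = t j" if "i \<in> X" "j \<in> X" "fst (t i) = fst (t j)" for i j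
      using that less[of i j] less[of j i] total[of i j] by (metis less_irrefl)
    moreover have "carrier (t i) \<subseteq> {..<fst (t j)}" if "i \<in> X" "j \<in> X" "fst (t i) < fst (t j)" for i j
      using that below[of j i] le_imp[of i j] by (metis less_imp_le less_irrefl)
    ultimately show "strongly_disjoint (t ` X)" unfolding strongly_disjoint_iff by blast
    show "t ` X \<noteq> {}" using X(2) by blast
    show "\<exists>s'\<in>t ` X. fst s < fst s'" if "s \<in> t ` X" for s
    proof -
      obtain i where i: "i \<in> X" "s = t i" using \<open>s \<in> t ` X\<close> by blast
      obtain j where j: "j \<in> X" "(j, i) \<notin> R" using nomax[OF i(1)] by blast
      then have "\<not> fst (t j) \<le> fst (t i)" using le_imp[OF j(1) i(1)] by blast
      then show ?thesis using i j(1) by (metis imageI not_le)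
    qed
  qed (rule small)
  have "\<beta> < fst (sum_triple (t ` X))"
  proof -
    have "fst (sum_triple (t ` X)) \<in> S.U"
      using triple_fst_mem[OF goodD(1)[OF S.good_sum]] S.sel(2) by simp
    then obtain i where i: "i \<in> X" "fst (sum_triple (t ` X)) \<in> carrier (t i)"
      unfolding S.U_def by blast
    have "fst (t i) \<le> fst (sum_triple (t ` X))" by (rule triple_carrier_ge[OF triple[OF i(1)] i(2)])
    then show ?thesis using t(2)[OF i(1)] by simp
  qed
  moreover have "finer (p i) (sum_triple (t ` X))" if i: "i \<in> X" for i
    unfolding finer_def
  proof (intro allI impI)
    fix A assume A: "\<forall>s\<in>p i. A \<inter> carrier s \<in> filt s"
    have "(A \<inter> S.U) \<inter> carrier (t j) \<in> filt (t j)" if j: "j \<in> X" "fst (t i) \<le> fst (t j)" for j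
    proof -
      have "finer (p i) (t j)" using t(3)[OF j(1) i le_imp[OF i j]] .
      then have "A \<inter> carrier (t j) \<in> filt (t j)" using A unfolding finer_def by blast
      moreover have "(A \<inter> S.U) \<inter> carrier (t j) = A \<inter> carrier (t j)"
        using S.carrier_sub_U[of "t j"] j(1) by blast
      ultimately show ?thesis by simp
    qed
    then have "S.tail (t i) (A \<inter> S.U)" unfolding S.tail_def by blast
    then show "A \<inter> carrier (sum_triple (t ` X)) \<in> filt (sum_triple (t ` X))"
      unfolding S.sel S.mem_filt_sum using i by blast
  qed
  ultimately show ?thesis using S.good_sum by blast
qed

text \<open>Only a chain without a last member needs a sum. If there is a last member
  \<open>p m\<close>, one of its triples far enough out is already finer than every
  \<open>p i\<close>.\<close>

lemma common_finer:
  fixes p :: "'i \<Rightarrow> 'a triple set" and R :: "'i rel"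
  assumes wo: "Well_order R" and X: "X \<subseteq> Field R" "|X| <o (lam :: 'a rel)"
    and p: "\<And>i. i \<in> X \<Longrightarrow> goodQ (p i)"
    and e: "\<And>i j. i \<in> X \<Longrightarrow> j \<in> X \<Longrightarrow> (i, j) \<in> R \<Longrightarrow> i \<noteq> j \<Longrightarrow> evfiner (p i) (p j)"
  shows "\<exists>t\<in>good. \<beta> < fst t \<and> (\<forall>i\<in>X. finer (p i) t)"
proof -
  have step: "\<exists>t\<in>p i. \<beta> < fst t \<and> (\<forall>j\<in>X. (j, i) \<in> R \<longrightarrow> finer (p j) t)" if i: "i \<in> X" for i \<beta>
  proof -
    have "\<exists>\<epsilon>. \<forall>t\<in>p i. \<epsilon> \<le> fst t \<longrightarrow> finer (p j) t" if "j \<in> X" "(j, i) \<in> R" for j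
      using e[OF that(1) i that(2)] evfiner_refl[of "p i"] unfolding evfiner_def by metis
    then obtain \<epsilon> where \<epsilon>: "\<And>j t. j \<in> X \<Longrightarrow> (j, i) \<in> R \<Longrightarrow> t \<in> p i \<Longrightarrow> \<epsilon> j \<le> fst t \<Longrightarrow> finer (p j) t"
      by metis
    obtain b where b: "\<And>j. j \<in> X \<Longrightarrow> \<epsilon> j < b" using small_image_bounded[OF X(2), of \<epsilon>] by blast
    obtain t where t: "t \<in> p i" "max b \<beta> < fst t" using goodQD(3)[OF p[OF i]] by blast
    have "finer (p j) t" if "j \<in> X" "(j, i) \<in> R" for j
      by (rule \<epsilon>[OF that t(1)]) (use b[OF that(1)] t(2) in \<open>meson less_imp_le less_trans max_less_iff_conj\<close>)
    then show ?thesis using t by (intro bexI[of _ t]) simp_all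
  qed
  consider "X = {}" | m where "m \<in> X" "\<forall>j\<in>X. (j, m) \<in> R"
    | "X \<noteq> {}" "\<And>i. i \<in> X \<Longrightarrow> \<exists>j\<in>X. (j, i) \<notin> R" by blast
  then show ?thesis
  proof cases
    case 1
    then show ?thesis using good_above[of \<beta>] by blast
  next
    case 2
    obtain t where t: "t \<in> p m" "\<beta> < fst t" "\<forall>j\<in>X. (j, m) \<in> R \<longrightarrow> finer (p j) t"
      using step[OF 2(1)] by blast
    moreover have "t \<in> good" using t(1) goodQD(1)[OF p[OF 2(1)]] by blast
    ultimately show ?thesis using 2(2) by blast
  next
    case 3
    show ?thesis
      by (rule sum_common_finer[OF wo X(1) 3(1) X(2) 3(2)])
        (use goodQD(1)[OF p] step in blast)+
  qed
qed

text \<open>\<open>Y\<close> is exhausted by the increasing small sets \<open>X \<gamma>\<close>.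
  The triple chosen at stage \<open>\<gamma>\<close> is finer than all \<open>p i\<close> with
  \<open>i\<close> in \<open>X \<gamma>\<close>, and each \<open>i\<close> of \<open>Y\<close> stays
  in from \<open>\<gamma> = g i\<close> on. Successors and limits of any cofinality up to \<lambda>
  are thus treated alike.\<close>

lemma goodQ_upper_bound:
  fixes p :: "'i \<Rightarrow> 'a triple set" and R :: "'i rel"
  assumes wo: "Well_order R" and Y: "Y \<subseteq> Field R" "|Y| \<le>o |UNIV :: 'a set|"
    and p: "\<And>i. i \<in> Y \<Longrightarrow> goodQ (p i)"
    and e: "\<And>i j. i \<in> Y \<Longrightarrow> j \<in> Y \<Longrightarrow> (i, j) \<in> R \<Longrightarrow> i \<noteq> j \<Longrightarrow> evfiner (p i) (p j)"
  shows "\<exists>r. goodQ r \<and> (\<forall>i\<in>Y. evfiner (p i) r)"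
proof -
  obtain g :: "'i \<Rightarrow> 'a" where g: "inj_on g Y"
    using Y(2) card_of_ordLeq[of Y "UNIV :: 'a set"] by blast
  define X where "X \<gamma> = {i \<in> Y. g i \<le> \<gamma>}" for \<gamma>
  have X: "|X \<gamma>| <o (lam :: 'a rel)" for \<gamma>
  proof -
    obtain b where "\<gamma> < b" using ex_greater by blast
    then have "g ` X \<gamma> \<subseteq> {..<b}" unfolding X_def by auto
    moreover have "inj_on g (X \<gamma>)" using g unfolding X_def inj_on_def by blast
    ultimately have "|X \<gamma>| \<le>o |{..<b}|" using card_of_ordLeq[of "X \<gamma>" "{..<b}"] by blast
    then show ?thesis using small_segment ordLeq_ordLess_trans by blast
  qed
  define S where "S \<gamma> = {t \<in> good. \<forall>i\<in>X \<gamma>. finer (p i) t}" for \<gamma>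
  have S1: "S \<gamma> \<subseteq> triples" for \<gamma> using goodD(1) unfolding S_def by blast
  have S2: "\<exists>t\<in>S \<gamma>. \<beta> < fst t" for \<gamma> \<beta>
  proof -
    have XY: "X \<gamma> \<subseteq> Y" unfolding X_def by blast
    have "\<exists>t\<in>good. \<beta> < fst t \<and> (\<forall>i\<in>X \<gamma>. finer (p i) t)"
      by (rule common_finer[OF wo _ X]) (use XY Y(1) p e in blast)+
    then show ?thesis unfolding S_def by blast
  qed
  obtain t where t: "increasing t" "\<And>\<gamma>. t \<gamma> \<in> S \<gamma>" using thinning[of S, OF S1 S2] by metis
  have "goodQ (range t)" by (rule goodQ_range[OF t(1)]) (use t(2) in \<open>simp add: S_def\<close>)
  moreover have "evfiner (p i) (range t)" if i: "i \<in> Y" for i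
  proof (rule evfiner_range[OF t(1)])
    show "finer (p i) (t \<gamma>)" if "g i \<le> \<gamma>" for \<gamma>
      using t(2)[of \<gamma>] i that unfolding S_def X_def by blast
  qed
  ultimately show ?thesis by blast
qed

section \<open>One step of the recursion\<close>

text \<open>The triples on which \<open>A\<close> is positive can be restricted to \<open>A\<close>.
  If their first coordinates are bounded, the complement of \<open>A\<close> is already in
  \<open>fil p\<close>.\<close>

lemma goodQ_decide:
  assumes p: "goodQ (p :: 'a triple set)"
  shows "\<exists>r. goodQ r \<and> evfiner p r \<and> (A \<in> fil r \<or> UNIV - A \<in> fil r)"
proof (cases "\<forall>\<beta>. \<exists>t\<in>p. \<beta> < fst t \<and> A \<inter> carrier t \<in> pos t")
  case True
  define S where "S = (\<lambda>t. restr t (A \<inter> carrier t)) ` {t \<in> p. A \<inter> carrier t \<in> pos t}"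
  have S: "s \<in> good" "finer p s" "carrier s \<subseteq> A" if s: "s \<in> S" for s
  proof -
    obtain t where t: "t \<in> p" "A \<inter> carrier t \<in> pos t" "s = restr t (A \<inter> carrier t)"
      using s unfolding S_def by blast
    show "s \<in> good" using good_restr[OF _ t(2)] goodQD(1)[OF p] t(1,3) by blast
    show "finer p s" using finer_restr[OF finer_self[OF t(1)] t(2)] t(3) by simp
    show "carrier s \<subseteq> A" using t(3) by simp
  qed
  have S1: "S \<subseteq> triples" using S(1) goodD(1) by blast
  have S2: "\<exists>s\<in>S. \<beta> < fst s" for \<beta>
  proof -
    obtain t where t: "t \<in> p" "\<beta> < fst t" "A \<inter> carrier t \<in> pos t" using True by blast
    have "fst t \<le> fst (restr t (A \<inter> carrier t))"
      using restr_fst_ge[OF _ t(3)] goodQD(4)[OF p] t(1) by blast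
    then have "\<beta> < fst (restr t (A \<inter> carrier t))" using t(2) by (rule order_less_le_trans[rotated])
    moreover have "restr t (A \<inter> carrier t) \<in> S" unfolding S_def using t by blast
    ultimately show ?thesis by blast
  qed
  obtain t where t: "increasing t" "\<And>\<gamma>. t \<gamma> \<in> S"
    using thinning[of "\<lambda>_. S", OF S1 S2] by metis
  have "goodQ (range t)" using goodQ_range[OF t(1) S(1)[OF t(2)]] .
  moreover have "evfiner p (range t)" using evfiner_range[OF t(1) S(2)[OF t(2)]] .
  moreover have "A \<inter> carrier (t \<gamma>) \<in> filt (t \<gamma>)" for \<gamma>
  proof -
    have "A \<inter> carrier (t \<gamma>) = carrier (t \<gamma>)" using S(3)[OF t(2)] by blast
    then show ?thesis using carrier_mem_filt[OF goodD(1)[OF S(1)[OF t(2)]]] by simp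
  qed
  then have "A \<in> fil (range t)" unfolding mem_fil_iff by blast
  ultimately show ?thesis by blast
next
  case False
  then obtain \<beta> where \<beta>: "\<And>t. t \<in> p \<Longrightarrow> \<beta> < fst t \<Longrightarrow> A \<inter> carrier t \<notin> pos t" by blast
  obtain b where b: "\<beta> < b" using ex_greater by blast
  have "(UNIV - A) \<inter> carrier t \<in> filt t" if t: "t \<in> p" "b \<le> fst t" for t
  proof -
    have "proper_filter_on (carrier t) (filt t)" using t(1) goodQD(1)[OF p] goodD(2) by blast
    then have "carrier t - A \<in> filt t" using \<beta>[OF t(1)] b t(2) by (intro diff_mem_filter) simp_all
    moreover have "(UNIV - A) \<inter> carrier t = carrier t - A" by blast
    ultimately show ?thesis by simp
  qed
  then have "UNIV - A \<in> fil p" unfolding mem_fil_iff by blast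
  then show ?thesis using p evfiner_refl by blast
qed

text \<open>In the application \<open>g\<close> sends \<open>\<delta>\<close> to
  \<open>\<delta> + f(\<delta>)\<close>. Triples before index \<open>\<gamma>\<close> end below
  \<open>gap t \<gamma>\<close>, and those from \<open>\<gamma>\<close> on start at or after
  \<open>g (gap t \<gamma>)\<close>, so the intervals attached to the gaps miss every
  carrier.\<close>

lemma goodQ_club:
  fixes g :: "'a \<Rightarrow> 'a"
  assumes p: "goodQ p"
  shows "\<exists>r. goodQ r \<and> evfiner p r \<and> (\<exists>C. club C \<and> UNIV - (\<Union>\<delta>\<in>C. {\<delta>..<g \<delta>}) \<in> fil r)"
proof -
  obtain t where t: "increasing t" "\<And>\<gamma>. t \<gamma> \<in> p" "\<And>\<gamma>. gap t \<gamma> \<le> fst (t \<gamma>)"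
    "\<And>\<gamma>. g (gap t \<gamma>) \<le> fst (t \<gamma>)"
    using thinning[of "\<lambda>_. p" g, OF goodQD(4)[OF p] goodQD(3)[OF p]] by metis
  have tt: "t \<gamma> \<in> triples" for \<gamma> using t(2) goodQD(4)[OF p] by blast
  have fst_gap: "fst (t \<gamma>') < gap t \<gamma>" if "\<gamma>' < \<gamma>" for \<gamma>' \<gamma>
    using gap_bound[of t, OF tt that] triple_fst_mem[OF tt, of \<gamma>'] by blast
  have gap_less: "gap t \<gamma>' < gap t \<gamma>" if "\<gamma>' < \<gamma>" for \<gamma>' \<gamma>
    using fst_gap[OF that] t(3)[of \<gamma>'] by simp
  have gap_less_iff: "gap t \<gamma>' < gap t \<gamma> \<longleftrightarrow> \<gamma>' < \<gamma>" for \<gamma>' \<gamma>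
    by (metis gap_less less_asym neqE)
  have "club (range (gap t))"
    unfolding club_def
  proof (intro conjI allI impI)
    show unb: "unbounded_in_lam (range (gap t))"
      unfolding unbounded_in_lam_def
    proof
      fix \<alpha> :: 'a
      obtain b where b: "\<alpha> < b" using ex_greater by blast
      have "\<alpha> \<le> fst (t \<alpha>)" by (rule increasing_fst_ge[OF t(1)])
      then have "\<alpha> < gap t b" using fst_gap[OF b] by simp
      then show "\<exists>\<beta>\<in>range (gap t). \<alpha> < \<beta>" by blast
    qed
    fix \<delta> :: 'a
    assume d: "{..<\<delta>} \<noteq> {} \<and> (\<forall>\<beta><\<delta>. \<exists>\<gamma>\<in>range (gap t). \<beta> < \<gamma> \<and> \<gamma> < \<delta>)"
    \<comment> \<open>All earlier gaps lie below \<open>\<delta>\<close>, so closedness amounts to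
      continuity of \<open>gap t\<close> at this index.\<close>
    define \<gamma> where "\<gamma> = (LEAST \<gamma>. \<delta> \<le> gap t \<gamma>)"
    have "\<exists>\<gamma>. \<delta> \<le> gap t \<gamma>" using unb unfolding unbounded_in_lam_def by (metis imageE less_imp_le)
    then have le: "\<delta> \<le> gap t \<gamma>" unfolding \<gamma>_def by (rule LeastI_ex)
    have "carrier (t \<gamma>') \<subseteq> {..<\<delta>}" if "\<gamma>' < \<gamma>" for \<gamma>'
    proof -
      have "gap t \<gamma>' < \<delta>" using that not_less_Least unfolding \<gamma>_def by (metis not_le)
      \<comment> \<open>\<open>gap t \<gamma>'\<close> bounds only the carriers before
        \<open>\<gamma>'\<close>; for the carrier of \<open>t \<gamma>'\<close> itself a larger gap
        below \<open>\<delta>\<close> is needed.\<close>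
      then obtain \<gamma>'' where 1: "gap t \<gamma>' < gap t \<gamma>''" "gap t \<gamma>'' < \<delta>" using d by blast
      have "carrier (t \<gamma>') \<subseteq> {..<gap t \<gamma>''}"
        using gap_bound[of t, OF tt] 1(1) gap_less_iff by blast
      then show ?thesis using 1(2) by auto
    qed
    then have "gap t \<gamma> \<le> \<delta>" by (rule gap_le)
    then show "\<delta> \<in> range (gap t)" using le by (metis antisym rangeI)
  qed
  moreover have "(UNIV - (\<Union>\<delta>\<in>range (gap t). {\<delta>..<g \<delta>})) \<inter> carrier (t \<gamma>) \<in> filt (t \<gamma>)" for \<gamma>
  proof -
    have "x \<notin> {gap t \<gamma>'..<g (gap t \<gamma>')}" if x: "x \<in> carrier (t \<gamma>)" for x \<gamma>'
    proof (cases "\<gamma> < \<gamma>'")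
      case True
      then have "x < gap t \<gamma>'" using gap_bound[of t, OF tt True] x by blast
      then show ?thesis by auto
    next
      case False
      then have "fst (t \<gamma>') \<le> fst (t \<gamma>)" using increasing_fst_less_iff[OF t(1)] by (meson not_le)
      then have "g (gap t \<gamma>') \<le> x"
        using t(4)[of \<gamma>'] triple_carrier_ge[OF tt x] by order
      then show ?thesis by auto
    qed
    then have "(UNIV - (\<Union>\<delta>\<in>range (gap t). {\<delta>..<g \<delta>})) \<inter> carrier (t \<gamma>) = carrier (t \<gamma>)"
      by blast
    then show ?thesis using carrier_mem_filt[OF tt] by simp
  qed
  then have "UNIV - (\<Union>\<delta>\<in>range (gap t). {\<delta>..<g \<delta>}) \<in> fil (range t)" unfolding mem_fil_iff by blast
  moreover have "goodQ (range t)" using goodQ_range[OF t(1)] t(2) goodQD(1)[OF p] by blast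
  moreover have "evfiner p (range t)" using evfiner_range[OF t(1) finer_self[OF t(2)]] .
  ultimately show ?thesis by blast
qed

text \<open>Thinning with a function \<open>h\<close> that bounds the reach of \<open>q\<close>
  makes each member of \<open>q\<close> meet at most one \<open>t \<gamma>\<close>. Each
  \<open>t \<gamma>\<close> is then restricted to a set \<open>B \<gamma>\<close> null for
  \<open>q\<close>, and the union of these sets is still null for every member of
  \<open>q\<close>.\<close>

lemma goodQ_avoid_ultra:
  assumes p: "goodQ (p :: 'a triple set)" and q: "q \<in> Q_zero F_ult"
  shows "\<exists>r. goodQ r \<and> evfiner p r \<and> (\<exists>A\<in>fil q. UNIV - A \<in> fil r)"
proof -
  have q: "q \<subseteq> F_ult" "strongly_disjoint q"
    using q unfolding Q_zero_def Q_star_def by blast+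
  then have qt: "q \<subseteq> triples" using F_ult_sub_triples by (meson order_trans)
  \<comment> \<open>Members of \<open>q\<close> are determined by their first coordinates, so fewer
    than \<lambda> of them start below \<open>x\<close>, and their carriers have a common
    bound.\<close>
  have "\<exists>b. \<forall>s\<in>q. fst s < x \<longrightarrow> carrier s \<subseteq> {..<b}" for x
  proof -
    let ?I = "{s \<in> q. fst s < x}"
    have "inj_on fst ?I" using q(2) unfolding strongly_disjoint_iff inj_on_def by blast
    moreover have "fst ` ?I \<subseteq> {..<x}" by blast
    ultimately have "|?I| \<le>o |{..<x}|" using card_of_ordLeq[of ?I "{..<x}"] by blast
    then have I: "|?I| <o (lam :: 'a rel)" using small_segment ordLeq_ordLess_trans by blast
    have *: "|carrier s| <o (lam :: 'a rel)" if "s \<in> ?I" for s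
      using that qt mem_triples_iff by blast
    obtain b where "\<forall>s\<in>?I. carrier s \<subseteq> {..<b}"
      using small_Union_bounded[OF I *] ..
    then show ?thesis by (intro exI[of _ b]) blast
  qed
  then obtain h where h: "\<And>x s. s \<in> q \<Longrightarrow> fst s < x \<Longrightarrow> carrier s \<subseteq> {..<h x}" by metis
  obtain t where t: "increasing t" "\<And>\<gamma>. t \<gamma> \<in> p" "\<And>\<gamma>. gap t \<gamma> \<le> fst (t \<gamma>)"
    "\<And>\<gamma>. h (gap t \<gamma>) \<le> fst (t \<gamma>)"
    using thinning[of "\<lambda>_. p" h, OF goodQD(4)[OF p] goodQD(3)[OF p]] by metis
  have tg: "t \<gamma> \<in> good" and tt: "t \<gamma> \<in> triples" for \<gamma>
    using t(2) goodQD(1,4)[OF p] by blast+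
  have once: "carrier s \<inter> carrier (t \<gamma>) = {}"
    if s: "s \<in> q" "carrier s \<inter> carrier (t \<gamma>') \<noteq> {}" "\<gamma>' < \<gamma>" for s \<gamma> \<gamma>'
  proof -
    obtain x where x: "x \<in> carrier s" "x \<in> carrier (t \<gamma>')" using s(2) by blast
    have "x < gap t \<gamma>" using gap_bound[of t, OF tt s(3)] x(2) by blast
    moreover have "fst s \<le> x" using triple_carrier_ge x(1) s(1) qt by blast
    ultimately have "fst s < gap t \<gamma>" by simp
    then have "carrier s \<subseteq> {..<h (gap t \<gamma>)}" by (rule h[OF s(1)])
    then have "carrier s \<subseteq> {..<fst (t \<gamma>)}" using t(4)[of \<gamma>] by auto
    moreover have "fst (t \<gamma>) \<le> y" if "y \<in> carrier (t \<gamma>)" for y by (rule triple_carrier_ge[OF tt that])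
    ultimately show ?thesis by fastforce
  qed
  have "\<exists>B. B \<in> pos (t \<gamma>) \<and> (\<forall>s\<in>q. carrier s - B \<in> filt s)" for \<gamma>
  proof -
    have "carrier (t \<gamma>) \<in> pos (t \<gamma>)"
      by (rule whole_mem_positive[OF goodD(2)[OF tg]])
    then show ?thesis using avoidingD[OF goodD(4)[OF tg] q] by metis
  qed
  then obtain B where B: "\<And>\<gamma>. B \<gamma> \<in> pos (t \<gamma>)" "\<And>\<gamma> s. s \<in> q \<Longrightarrow> carrier s - B \<gamma> \<in> filt s"
    by metis
  have Bt: "B \<gamma> \<subseteq> carrier (t \<gamma>)" for \<gamma> using B(1)[of \<gamma>] unfolding positive_sets_def by blast
  define u where "u \<gamma> = restr (t \<gamma>) (B \<gamma>)" for \<gamma>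
  have ug: "u \<gamma> \<in> good" for \<gamma> unfolding u_def by (rule good_restr[OF tg B(1)])
  have cu: "carrier (u \<gamma>) = B \<gamma>" for \<gamma> by (simp add: u_def)
  have "carrier (u \<gamma>') \<subseteq> {..<fst (u \<gamma>)}" if "\<gamma>' < \<gamma>" for \<gamma>' \<gamma>
  proof -
    have "carrier (t \<gamma>') \<subseteq> {..<fst (t \<gamma>)}" using t(1) that unfolding increasing_def by blast
    moreover have "fst (t \<gamma>) \<le> fst (u \<gamma>)" unfolding u_def by (rule restr_fst_ge[OF tt B(1)])
    ultimately show ?thesis unfolding cu using Bt[of \<gamma>'] by fastforce
  qed
  then have u: "increasing u" unfolding increasing_def using goodD(1)[OF ug] by blast
  have "goodQ (range u)" by (rule goodQ_range[OF u ug])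
  moreover have "evfiner p (range u)"
    by (rule evfiner_range[OF u]) (unfold u_def, rule finer_restr[OF finer_self[OF t(2)] B(1)])
  moreover have "carrier s - (\<Union>\<gamma>. B \<gamma>) \<in> filt s" if s: "s \<in> q" for s
  proof (cases "\<exists>\<gamma>. carrier s \<inter> carrier (t \<gamma>) \<noteq> {}")
    case True
    then obtain \<gamma> where \<gamma>: "carrier s \<inter> carrier (t \<gamma>) \<noteq> {}" by blast
    have "carrier s \<inter> carrier (t \<gamma>') = {}" if "\<gamma>' \<noteq> \<gamma>" for \<gamma>'
      using once[OF s] \<gamma> that by (metis neqE)
    then have "x \<notin> B \<gamma>'" if "x \<in> carrier s" "\<gamma>' \<noteq> \<gamma>" for x \<gamma>'
      using that Bt[of \<gamma>'] by blast
    then have "x \<in> (\<Union>\<gamma>. B \<gamma>) \<longleftrightarrow> x \<in> B \<gamma>" if "x \<in> carrier s" for x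
      using that by (metis UN_iff UNIV_I)
    then have "carrier s - (\<Union>\<gamma>. B \<gamma>) = carrier s - B \<gamma>" by blast
    then show ?thesis using B(2)[OF s] by simp
  next
    case False
    then have "carrier s - (\<Union>\<gamma>. B \<gamma>) = carrier s" using Bt by blast
    then show ?thesis using carrier_mem_filt[of s] s qt by (metis subsetD)
  qed
  moreover have "(UNIV - (\<Union>\<gamma>. B \<gamma>)) \<inter> Z = Z - (\<Union>\<gamma>. B \<gamma>)" for Z by blast
  ultimately have "UNIV - (\<Union>\<gamma>. B \<gamma>) \<in> fil q" unfolding mem_fil_iff by metis
  moreover have "(\<Union>\<gamma>. B \<gamma>) \<inter> carrier (u \<gamma>) \<in> filt (u \<gamma>)" for \<gamma>
  proof -
    have "(\<Union>\<gamma>. B \<gamma>) \<inter> carrier (u \<gamma>) = carrier (u \<gamma>)" unfolding cu by blast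
    then show ?thesis using carrier_mem_filt[OF goodD(1)[OF ug]] by simp
  qed
  then have "(\<Union>\<gamma>. B \<gamma>) \<in> fil (range u)" unfolding mem_fil_iff by blast
  then have "UNIV - (UNIV - (\<Union>\<gamma>. B \<gamma>)) \<in> fil (range u)" by (simp add: double_diff)
  ultimately show ?thesis using \<open>goodQ (range u)\<close> \<open>evfiner p (range u)\<close> by blast
qed

lemma goodQ_mem_Q_zero:
  assumes p: "goodQ (p :: 'a triple set)"
  shows "p \<in> Q_zero F_unu"
proof -
  have inj: "inj_on fst p" using goodQD(2)[OF p] unfolding strongly_disjoint_iff inj_on_def by blast
  have "cofinal (fst ` p) (lam :: 'a rel)"
    unfolding cofinal_def lam_iff
  proof
    fix a :: 'a
    obtain t where "t \<in> p" "a < fst t" using goodQD(3)[OF p] by blast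
    then show "\<exists>b\<in>fst ` p. a \<noteq> b \<and> a \<le> b" by (intro bexI[of _ "fst t"]) auto
  qed
  then have "|fst ` p| =o (lam :: 'a rel)"
    using reg Field_lam unfolding regularCard_def by (metis subset_UNIV)
  moreover have "|p| =o |fst ` p|"
    using inj card_of_ordIso inj_on_imp_bij_betw by blast
  ultimately have "|p| =o (lam :: 'a rel)" by (metis ordIso_transitive)
  moreover have "|{t \<in> p. fst t = \<alpha>}| <o (lam :: 'a rel)" for \<alpha>
  proof -
    obtain b where "\<alpha> < b" using ex_greater by blast
    then have "fst ` {t \<in> p. fst t = \<alpha>} \<subseteq> {..<b}" by blast
    moreover have "inj_on fst {t \<in> p. fst t = \<alpha>}" using inj unfolding inj_on_def by blast
    ultimately have "|{t \<in> p. fst t = \<alpha>}| \<le>o |{..<b}|"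
      using card_of_ordLeq[of "{t \<in> p. fst t = \<alpha>}" "{..<b}"] by blast
    then show ?thesis using small_segment ordLeq_ordLess_trans by blast
  qed
  moreover have "p \<subseteq> F_unu" using goodQD(1)[OF p] goodD(5) by blast
  ultimately show ?thesis using goodQD(2)[OF p] unfolding Q_zero_def Q_star_def by blast
qed

text \<open>The last clause is the source of uniformity, since by regularity an unbounded set has
  size \<lambda>. It holds because triples of \<open>p\<close> start arbitrarily late and members of
  their filters are non-empty.\<close>

lemma goodQ_fil:
  assumes p: "goodQ (p :: 'a triple set)"
  shows "UNIV \<in> fil p" "A \<in> fil p \<Longrightarrow> B \<in> fil p \<Longrightarrow> A \<inter> B \<in> fil p"
    "A \<in> fil p \<Longrightarrow> A \<subseteq> B \<Longrightarrow> B \<in> fil p" "A \<in> fil p \<Longrightarrow> \<not> A \<subseteq> {..<b}"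
proof -
  have F: "proper_filter_on (carrier t) (filt t)" if "t \<in> p" for t
    using that goodQD(1)[OF p] goodD(2) by blast
  show "UNIV \<in> fil p" unfolding mem_fil_iff using proper_filter_onD(2)[OF F] by simp
  {
    assume "A \<in> fil p" "B \<in> fil p"
    then obtain a b where a: "\<forall>t\<in>p. a \<le> fst t \<longrightarrow> A \<inter> carrier t \<in> filt t"
      and b: "\<forall>t\<in>p. b \<le> fst t \<longrightarrow> B \<inter> carrier t \<in> filt t" unfolding mem_fil_iff by blast
    have "A \<inter> B \<inter> carrier t \<in> filt t" if t: "t \<in> p" "max a b \<le> fst t" for t
    proof -
      have "(A \<inter> carrier t) \<inter> (B \<inter> carrier t) \<in> filt t"
        by (rule proper_filter_onD(4)[OF F[OF t(1)]]) (use a b t in \<open>metis max.bounded_iff\<close>)+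
      moreover have "(A \<inter> carrier t) \<inter> (B \<inter> carrier t) = A \<inter> B \<inter> carrier t" by blast
      ultimately show ?thesis by simp
    qed
    then show "A \<inter> B \<in> fil p" unfolding mem_fil_iff by blast
  next
    assume "A \<in> fil p" "A \<subseteq> B"
    then obtain a where a: "\<forall>t\<in>p. a \<le> fst t \<longrightarrow> A \<inter> carrier t \<in> filt t"
      unfolding mem_fil_iff by blast
    have "B \<inter> carrier t \<in> filt t" if t: "t \<in> p" "a \<le> fst t" for t
      by (rule filter_mem_mono[OF F[OF t(1)], of A]) (use a t \<open>A \<subseteq> B\<close> in blast)+
    then show "B \<in> fil p" unfolding mem_fil_iff by blast
  next
    assume "A \<in> fil p"
    then obtain a where a: "\<forall>t\<in>p. a \<le> fst t \<longrightarrow> A \<inter> carrier t \<in> filt t"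
      unfolding mem_fil_iff by blast
    obtain t where t: "t \<in> p" "max a b < fst t" using goodQD(3)[OF p] by blast
    then have "A \<inter> carrier t \<in> filt t" using a by (metis less_imp_le max_less_iff_conj)
    then have "A \<inter> carrier t \<noteq> {}" using proper_filter_onD(3)[OF F[OF t(1)]] by metis
    then obtain x where x: "x \<in> A" "x \<in> carrier t" by blast
    have "fst t \<le> x" using triple_carrier_ge[OF _ x(2)] t(1) goodQD(4)[OF p] by blast
    then have "x \<notin> {..<b}" using t(2) by auto
    then show "\<not> A \<subseteq> {..<b}" using x(1) by blast
  }
qed

text \<open>The guard on \<open>q\<close> allows an enumeration whose range merely includes
  \<open>Q_zero F_ult\<close>.\<close>

definition task :: "'a set \<Rightarrow> ('a \<Rightarrow> 'a) \<Rightarrow> 'a triple set \<Rightarrow> 'a triple set \<Rightarrow> bool" where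
  "task A g q r \<longleftrightarrow> (A \<in> fil r \<or> UNIV - A \<in> fil r) \<and>
     (\<exists>C. club C \<and> UNIV - (\<Union>\<delta>\<in>C. {\<delta>..<g \<delta>}) \<in> fil r) \<and>
     (q \<in> Q_zero F_ult \<longrightarrow> (\<exists>B\<in>fil q. UNIV - B \<in> fil r))"

text \<open>Each achievement is a membership in \<open>fil\<close>, and \<open>fil\<close> only
  grows along \<open>evfiner\<close>, so the three steps can be performed one after the
  other.\<close>

lemma goodQ_task:
  assumes p: "goodQ p"
  shows "\<exists>r. goodQ r \<and> evfiner p r \<and> task A g q r"
proof -
  obtain r1 where r1: "goodQ r1" "evfiner p r1" "A \<in> fil r1 \<or> UNIV - A \<in> fil r1"
    using goodQ_decide[OF p] by blast
  obtain r2 C where r2: "goodQ r2" "evfiner r1 r2" "club C" "UNIV - (\<Union>\<delta>\<in>C. {\<delta>..<g \<delta>}) \<in> fil r2"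
    using goodQ_club[OF r1(1)] by blast
  obtain r3 where r3: "goodQ r3" "evfiner r2 r3" "q \<in> Q_zero F_ult \<longrightarrow> (\<exists>B\<in>fil q. UNIV - B \<in> fil r3)"
    using goodQ_avoid_ultra[OF r2(1)] r2(1) evfiner_refl by blast
  have 12: "fil r1 \<subseteq> fil r2" by (rule evfiner_fil_mono[OF r1(1) goodQD(4)[OF r2(1)] r2(2)])
  have 23: "fil r2 \<subseteq> fil r3" by (rule evfiner_fil_mono[OF r2(1) goodQD(4)[OF r3(1)] r3(2)])
  have "evfiner p r2" by (rule evfiner_trans[OF r1(2,1) goodQD(4)[OF r2(1)] r2(2)])
  then have "evfiner p r3" using r2(1) goodQD(4)[OF r3(1)] r3(2) by (rule evfiner_trans)
  moreover have "task A g q r3"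
    unfolding task_def using r1(3) r2(3,4) r3(3) 12 23 by blast
  ultimately show ?thesis using r3(1) by blast
qed

section \<open>Counting the tasks\<close>

lemma Times_encode: "\<exists>f :: 'a \<times> 'a \<Rightarrow> 'a. inj f"
proof -
  have "|UNIV \<times> UNIV :: ('a \<times> 'a) set| =o |UNIV :: 'a set|"
    by (rule card_of_Times_same_infinite[OF infinite_UNIV])
  then show ?thesis
    using card_of_ordLeq[of "UNIV \<times> UNIV :: ('a \<times> 'a) set" "UNIV :: 'a set"] ordIso_imp_ordLeq
    by auto
qed

lemma functions_decode: "\<exists>G :: 'a set \<Rightarrow> ('a \<Rightarrow> 'a). surj G"
proof -
  obtain f :: "'a \<times> 'a \<Rightarrow> 'a" where f: "inj f" using Times_encode by blast
  \<comment> \<open>On the code of a graph the choice is unique; on other sets the value is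
    arbitrary, which does not affect surjectivity.\<close>
  define G where "G S \<delta> = (SOME y. f (\<delta>, y) \<in> S)" for S \<delta>
  have "G (range (\<lambda>x. f (x, h x))) = h" for h
  proof
    fix \<delta>
    have "f (\<delta>, y) \<in> range (\<lambda>x. f (x, h x)) \<longleftrightarrow> y = h \<delta>" for y
      using f unfolding inj_def by blast
    then show "G (range (\<lambda>x. f (x, h x))) \<delta> = h \<delta>" unfolding G_def by simp
  qed
  then have "surj G" by (rule surjI)
  then show ?thesis by blast
qed

text \<open>A bounded set is coded by its characteristic function on the segment below its least
  bound, which is a sequence of length less than \<lambda>.\<close>

lemma bounded_sets_encode:
  assumes short: "|short_seqs :: ('a \<rightharpoonup> 'a) set| =o (lam :: 'a rel)"
  shows "|{X :: 'a set. \<exists>b. X \<subseteq> {..<b}}| \<le>o |UNIV :: 'a set|"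
proof -
  obtain c d :: 'a where cd: "c < d" using ex_greater by blast
  define bd where "bd X = (LEAST b. X \<subseteq> {..<b})" for X :: "'a set"
  \<comment> \<open>Non-members below \<open>bd X\<close> get the value \<open>d\<close> rather than
    \<open>None\<close>, so that the domain is an initial segment, as \<open>short_seqs\<close>
    demands.\<close>
  define enc :: "'a set \<Rightarrow> 'a \<rightharpoonup> 'a" where
    "enc X x = (if x < bd X then Some (if x \<in> X then c else d) else None)" for X x
  let ?B = "{X :: 'a set. \<exists>b. X \<subseteq> {..<b}}"
  have bd: "X \<subseteq> {..<bd X}" if "X \<in> ?B" for X
  proof -
    have "\<exists>b. X \<subseteq> {..<b}" using that by blast
    then show ?thesis unfolding bd_def by (rule LeastI_ex)
  qed
  have mem: "x \<in> X \<longleftrightarrow> enc X x = Some c" if "X \<in> ?B" for x X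
    using bd[OF that] cd unfolding enc_def by auto
  have "inj_on enc ?B"
  proof (rule inj_onI)
    fix X Y assume "X \<in> ?B" "Y \<in> ?B" "enc X = enc Y"
    then show "X = Y" using mem[of X] mem[of Y] by (metis subsetI subset_antisym)
  qed
  moreover have "dom (enc X) = {..<bd X}" for X unfolding enc_def dom_def by auto
  then have "enc ` ?B \<subseteq> short_seqs" unfolding short_seqs_def by blast
  ultimately have "|?B| \<le>o |short_seqs :: ('a \<rightharpoonup> 'a) set|"
    using card_of_ordLeq[of ?B "short_seqs :: ('a \<rightharpoonup> 'a) set"] by blast
  then show ?thesis by (meson short lam_ordIso ordLeq_ordIso_trans)
qed

text \<open>Within a strongly disjoint \<open>q\<close>, the first coordinate determines the triple,
  and the carrier is the largest member of the filter. So \<open>q\<close> is recovered from the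
  pairs \<open>(fst t, A)\<close> with \<open>A\<close> in the filter of \<open>t\<close>. As such
  \<open>A\<close> are bounded, there are at most \<lambda> possible pairs, and \<open>q\<close>
  becomes a subset of \<lambda>.\<close>

lemma Q_zero_decode:
  assumes short: "|short_seqs :: ('a \<rightharpoonup> 'a) set| =o (lam :: 'a rel)"
  shows "\<exists>Q :: 'a set \<Rightarrow> 'a triple set. Q_zero F_ult \<subseteq> range Q"
proof -
  let ?B = "{X :: 'a set. \<exists>b. X \<subseteq> {..<b}}"
  have "|(UNIV :: 'a set) \<times> ?B| \<le>o |(UNIV :: 'a set) \<times> (UNIV :: 'a set)|"
    by (rule card_of_Times_mono2[OF bounded_sets_encode[OF short]])
  also have "|(UNIV :: 'a set) \<times> (UNIV :: 'a set)| =o |UNIV :: 'a set|"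
    by (rule card_of_Times_same_infinite[OF infinite_UNIV])
  finally obtain f :: "'a \<times> 'a set \<Rightarrow> 'a" where f: "inj_on f (UNIV \<times> ?B)"
    using card_of_ordLeq[of "(UNIV :: 'a set) \<times> ?B" "UNIV :: 'a set"] by blast
  define graph :: "'a triple set \<Rightarrow> ('a \<times> 'a set) set" where
    "graph q = {(\<alpha>, A). \<exists>t\<in>q. fst t = \<alpha> \<and> A \<in> filt t}" for q
  have Q: "q \<subseteq> triples" "strongly_disjoint q" if "q \<in> Q_zero F_ult" for q :: "'a triple set"
    using that F_ult_sub_triples unfolding Q_zero_def Q_star_def by blast+
  have sub: "graph q \<subseteq> UNIV \<times> ?B" if q: "q \<in> Q_zero F_ult" for q
  proof -
    have "A \<in> ?B" if A: "t \<in> q" "A \<in> filt t" for A t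
    proof -
      have t: "t \<in> triples" using A(1) Q(1)[OF q] by blast
      then have "|carrier t| <o (lam :: 'a rel)" using mem_triples_iff by blast
      then obtain b where "carrier t \<subseteq> {..<b}" using small_iff_bounded by blast
      moreover have "A \<subseteq> carrier t"
        using t A(2) proper_filter_onD(1) unfolding mem_triples_iff by blast
      ultimately show ?thesis by blast
    qed
    then show ?thesis unfolding graph_def by blast
  qed
  have le: "q \<subseteq> q'" if q: "q \<in> Q_zero F_ult" "q' \<in> Q_zero F_ult" "graph q = graph q'" for q q'
  proof
    fix t assume t: "t \<in> q"
    have tt: "t \<in> triples" using t Q(1)[OF q(1)] by blast
    have ex: "\<exists>s\<in>q'. fst s = fst t \<and> A \<in> filt s" if "A \<in> filt t" for A
    proof -
      have "(fst t, A) \<in> graph q'" using t that q(3) unfolding graph_def by blast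
      then show ?thesis unfolding graph_def by blast
    qed
    obtain s where s: "s \<in> q'" "fst s = fst t" using ex[OF carrier_mem_filt[OF tt]] by blast
    have ss: "s \<in> triples" using s Q(1)[OF q(2)] by blast
    have "A \<in> filt s" if A: "A \<in> filt t" for A
    proof -
      obtain s' where s': "s' \<in> q'" "fst s' = fst t" "A \<in> filt s'" using ex[OF A] by blast
      then have "s' = s" using s Q(2)[OF q(2)] unfolding strongly_disjoint_iff by metis
      then show ?thesis using s' by simp
    qed
    moreover have "A \<in> filt t" if "A \<in> filt s" for A
    proof -
      have "(fst s, A) \<in> graph q" using s(1) that q(3) unfolding graph_def by blast
      then obtain t' where t': "t' \<in> q" "fst t' = fst s" "A \<in> filt t'" unfolding graph_def by blast
      then have "t' = t" using s(2) t Q(2)[OF q(1)] unfolding strongly_disjoint_iff by metis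
      then show ?thesis using t' by simp
    qed
    ultimately have filt: "filt s = filt t" by blast
    have "carrier s \<subseteq> carrier t" "carrier t \<subseteq> carrier s"
      using carrier_mem_filt[OF ss] carrier_mem_filt[OF tt] filt tt ss proper_filter_onD(1)
      unfolding mem_triples_iff by metis+
    then have "s = t" using s(2) filt by (metis prod.expand subset_antisym)
    then show "t \<in> q'" using s(1) by simp
  qed
  have inj: "inj_on (\<lambda>q. f ` graph q) (Q_zero F_ult)"
  proof (rule inj_onI)
    fix q q' :: "'a triple set"
    assume q: "q \<in> Q_zero F_ult" "q' \<in> Q_zero F_ult" "f ` graph q = f ` graph q'"
    have "graph q = graph q'"
      using inj_on_image_eq_iff[OF f sub[OF q(1)] sub[OF q(2)]] q(3) by blast
    then show "q = q'" using le q by (metis subset_antisym)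
  qed
  have "q \<in> range (inv_into (Q_zero F_ult) (\<lambda>q. f ` graph q))" if "q \<in> Q_zero F_ult" for q
    using inv_into_f_f[OF inj that] by (metis rangeI)
  then show ?thesis by blast
qed

section \<open>The recursion\<close>

text \<open>\<open>cardSuc lam\<close> is a relation on \<open>'a set\<close>, which is why stages
  are sets. A stage has at most \<lambda> predecessors, so \<open>goodQ_upper_bound\<close> applies
  everywhere, including the first stage, where it merely supplies a starting point.\<close>

lemma goodQ_sequence:
  fixes A :: "'a set \<Rightarrow> 'a set" and g :: "'a set \<Rightarrow> 'a \<Rightarrow> 'a" and q :: "'a set \<Rightarrow> 'a triple set"
  shows "\<exists>p. \<forall>\<xi>. goodQ (p \<xi>) \<and> (\<forall>\<zeta>. (\<zeta>, \<xi>) \<in> cardSuc (lam :: 'a rel) - Id \<longrightarrow> evfiner (p \<zeta>) (p \<xi>)) \<and>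
    task (A \<xi>) (g \<xi>) (q \<xi>) (p \<xi>)"
proof -
  let ?R = "cardSuc (lam :: 'a rel)"
  let ?P = "\<lambda>f \<xi> r. goodQ r \<and> (\<forall>\<zeta>. (\<zeta>, \<xi>) \<in> ?R - Id \<longrightarrow> evfiner (f \<zeta>) r) \<and> task (A \<xi>) (g \<xi>) (q \<xi>) r"
  have R: "Card_order ?R" by (rule cardSuc_Card_order[OF Card_lam])
  then have wo: "Well_order ?R" by (rule card_order_on_well_order_on)
  then have "wf (?R - Id)" unfolding well_order_on_def by blast
  then show ?thesis
  proof (rule dependent_wf_choice[where P = ?P])
    fix f h :: "'a set \<Rightarrow> 'a triple set" and \<xi> r
    assume "\<And>z. (z, \<xi>) \<in> ?R - Id \<Longrightarrow> f z = h z"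
    then have "(\<forall>\<zeta>. (\<zeta>, \<xi>) \<in> ?R - Id \<longrightarrow> evfiner (f \<zeta>) r) = (\<forall>\<zeta>. (\<zeta>, \<xi>) \<in> ?R - Id \<longrightarrow> evfiner (h \<zeta>) r)"
      by metis
    then show "?P f \<xi> r = ?P h \<xi> r" by argo
  next
    fix \<xi> and f :: "'a set \<Rightarrow> 'a triple set"
    assume IH: "\<And>\<zeta>. (\<zeta>, \<xi>) \<in> ?R - Id \<Longrightarrow> ?P f \<zeta> (f \<zeta>)"
    have Y: "underS ?R \<xi> = {\<zeta>. (\<zeta>, \<xi>) \<in> ?R - Id}" unfolding underS_def by blast
    have small: "|underS ?R \<xi>| \<le>o |UNIV :: 'a set|"
    proof (cases "\<xi> \<in> Field ?R")
      case True
      have "|underS ?R \<xi>| <o ?R" by (rule card_of_underS[OF R True])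
      then have "|underS ?R \<xi>| \<le>o (lam :: 'a rel)"
        using cardSuc_ordLeq_ordLess[OF Card_lam card_of_Card_order] by blast
      then show ?thesis using lam_ordIso ordLeq_ordIso_trans by blast
    next
      \<comment> \<open>The recursion also assigns values to sets outside the field of
        \<open>cardSuc lam\<close>; these have no predecessors.\<close>
      case False
      then have "underS ?R \<xi> = {}" unfolding underS_def Field_def by blast
      then show ?thesis using card_of_empty by metis
    qed
    have "\<exists>r. goodQ r \<and> (\<forall>i\<in>underS ?R \<xi>. evfiner (f i) r)"
    proof (rule goodQ_upper_bound[OF wo _ small])
      show "underS ?R \<xi> \<subseteq> Field ?R" unfolding underS_def Field_def by blast
      show "goodQ (f i)" if "i \<in> underS ?R \<xi>" for i using IH[of i] that unfolding Y by blast
      show "evfiner (f i) (f j)" if "j \<in> underS ?R \<xi>" "(i, j) \<in> ?R" "i \<noteq> j" for i j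
        using IH[of j] that unfolding Y by blast
    qed
    then obtain r0 where r0: "goodQ r0" "\<And>\<zeta>. (\<zeta>, \<xi>) \<in> ?R - Id \<Longrightarrow> evfiner (f \<zeta>) r0"
      unfolding Y by blast
    obtain r where r: "goodQ r" "evfiner r0 r" "task (A \<xi>) (g \<xi>) (q \<xi>) r"
      using goodQ_task[OF r0(1)] by blast
    have "evfiner (f \<zeta>) r" if "(\<zeta>, \<xi>) \<in> ?R - Id" for \<zeta>
      by (rule evfiner_trans[OF r0(2)[OF that] r0(1) goodQD(4)[OF r(1)] r(2)])
    then show "\<exists>r. ?P f \<xi> r" using r by blast
  qed
qed

end

section \<open>The ultrafilter generated by the sequence\<close>

theorem theorem2p3:
  assumes cardinal: "card_order (lam :: 'a::wellorder rel)"
    and uncountable: "natLeq <o (lam :: 'a rel)"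
    and regular: "regularCard (lam :: 'a rel)"
    and short_exp: "|short_seqs :: ('a \<rightharpoonup> 'a) set| =o (lam :: 'a rel)"
    and two_exp: "ctwo ^c (lam :: 'a rel) =o cardSuc (lam :: 'a rel)"
  shows "\<exists>p :: 'a set \<Rightarrow> 'a triple set.
    (\<forall>\<xi>\<in>Field (cardSuc (lam :: 'a rel)). p \<xi> \<in> Q_zero F_unu) \<and>
    (\<forall>\<xi> \<zeta>. (\<xi>, \<zeta>) \<in> cardSuc (lam :: 'a rel) \<longrightarrow> p \<xi> \<le>\<^sup>* p \<zeta>) \<and>
    weakly_reasonable (fil_family (p ` Field (cardSuc (lam :: 'a rel)))) \<and>
    \<not> (\<exists>q\<in>Q_zero F_ult. fil q \<subseteq> fil_family (p ` Field (cardSuc (lam :: 'a rel))))"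
proof -
  interpret regular_lam "TYPE('a)" by standard (rule cardinal uncountable regular)+
  let ?R = "cardSuc (lam :: 'a rel)"
  have R: "Card_order ?R" by (rule cardSuc_Card_order[OF Card_lam])
  then have wo: "wo_rel ?R" unfolding wo_rel_def by (rule card_order_on_well_order_on)
  have "|Pow (UNIV :: 'a set)| =o ctwo ^c (lam :: 'a rel)"
    using card_of_Pow_Func[of "UNIV :: 'a set"] unfolding cexp_def ctwo_def Field_lam Field_card_of .
  then have "|UNIV :: 'a set set| =o |Field ?R|"
    using two_exp card_of_Field_ordIso[OF R]
    unfolding Pow_UNIV by (meson ordIso_symmetric ordIso_transitive)
  \<comment> \<open>One enumeration of the subsets of \<lambda> serves all tasks: a set
    \<open>S\<close> is at once the set to be decided, the code of the function \<open>G S\<close>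
    and the code of the family \<open>Q S\<close>. Every task of each kind has its stage because
    \<open>e\<close> is onto.\<close>
  then obtain e :: "'a set \<Rightarrow> 'a set" where "bij_betw e (Field ?R) UNIV"
    using card_of_ordIso[of "Field ?R" "UNIV :: 'a set set"] ordIso_symmetric by blast
  then have e: "\<exists>\<xi>\<in>Field ?R. e \<xi> = S" for S unfolding bij_betw_def by (metis UNIV_I imageE)
  obtain G :: "'a set \<Rightarrow> ('a \<Rightarrow> 'a)" where G: "surj G" using functions_decode by blast
  obtain Q :: "'a set \<Rightarrow> 'a triple set" where Q: "Q_zero F_ult \<subseteq> range Q"
    using Q_zero_decode[OF short_exp] by blast
  obtain p where p: "\<And>\<xi>. goodQ (p \<xi>)" "\<And>\<zeta> \<xi>. (\<zeta>, \<xi>) \<in> ?R - Id \<Longrightarrow> evfiner (p \<zeta>) (p \<xi>)"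
    "\<And>\<xi>. task (e \<xi>) (G (e \<xi>)) (Q (e \<xi>)) (p \<xi>)"
    using goodQ_sequence[of e "\<lambda>\<xi>. G (e \<xi>)" "\<lambda>\<xi>. Q (e \<xi>)"] by blast
  define D where "D = fil_family (p ` Field ?R)"
  have D: "X \<in> D \<longleftrightarrow> (\<exists>\<xi>\<in>Field ?R. X \<in> fil (p \<xi>))" for X
    unfolding D_def fil_family_def by blast
  have mono: "fil (p \<zeta>) \<subseteq> fil (p \<xi>)" if "(\<zeta>, \<xi>) \<in> ?R" for \<zeta> \<xi>
  proof (cases "\<zeta> = \<xi>")
    case False
    then show ?thesis using evfiner_fil_mono[OF p(1) goodQD(4)[OF p(1)] p(2)] that by blast
  qed simp
  have D_Int: "X \<inter> Y \<in> D" if XY: "X \<in> D" "Y \<in> D" for X Y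
  proof -
    obtain \<xi> \<zeta> where xz: "\<xi> \<in> Field ?R" "X \<in> fil (p \<xi>)" "\<zeta> \<in> Field ?R" "Y \<in> fil (p \<zeta>)"
      using XY unfolding D by blast
    have "(\<xi>, \<zeta>) \<in> ?R \<or> (\<zeta>, \<xi>) \<in> ?R" using wo_rel.TOTALS[OF wo] xz by blast
    then have "\<exists>\<eta>\<in>Field ?R. X \<in> fil (p \<eta>) \<and> Y \<in> fil (p \<eta>)" using mono xz by blast
    then show ?thesis unfolding D using goodQ_fil(2)[OF p(1)] by blast
  qed
  have D_unbounded: "\<not> X \<subseteq> {..<b}" if "X \<in> D" for X b
    using that goodQ_fil(4)[OF p(1)] unfolding D by blast
  have D_disjoint: False if "X \<in> D" "UNIV - X \<in> D" for X
  proof -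
    have "X \<inter> (UNIV - X) \<in> D" using D_Int that by blast
    then show False using D_unbounded by fastforce
  qed
  have "proper_filter_on UNIV D"
    unfolding proper_filter_on_def
  proof (intro conjI ballI allI impI)
    show "UNIV \<in> D" unfolding D using goodQ_fil(1)[OF p(1)] e by blast
    show "{} \<notin> D" using D_unbounded by blast
    show "X \<inter> Y \<in> D" if "X \<in> D" "Y \<in> D" for X Y using D_Int that by blast
    show "Y \<in> D" if "X \<in> D" "X \<subseteq> Y \<and> Y \<subseteq> UNIV" for X Y
      using that goodQ_fil(3)[OF p(1)] unfolding D by blast
  qed simp
  moreover have "X \<in> D \<or> UNIV - X \<in> D" for X
  proof -
    obtain \<xi> where "\<xi> \<in> Field ?R" "e \<xi> = X" using e by blast
    then show ?thesis using p(3)[of \<xi>] unfolding D task_def by blast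
  qed
  ultimately have "ultrafilter_on UNIV D" unfolding ultrafilter_on_def by blast
  moreover have "|X| =o (lam :: 'a rel)" if "X \<in> D" for X
  proof -
    have "\<not> |X| <o (lam :: 'a rel)" using D_unbounded[OF that] small_iff_bounded by blast
    moreover have "|X| \<le>o |UNIV :: 'a set|" by (rule card_of_mono1) simp
    then have "|X| \<le>o (lam :: 'a rel)"
      using lam_ordIso ordIso_symmetric ordLeq_ordIso_trans by blast
    ultimately show ?thesis using ordLeq_iff_ordLess_or_ordIso by blast
  qed
  moreover have "\<exists>C. club C \<and> (\<Union>\<delta>\<in>C. {\<delta>..<ord_add \<delta> (f \<delta>)}) \<notin> D" for f :: "'a \<Rightarrow> 'a"
  proof -
    obtain S where S: "G S = (\<lambda>\<delta>. ord_add \<delta> (f \<delta>))" using G by (metis surjD)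
    obtain \<xi> where \<xi>: "\<xi> \<in> Field ?R" "e \<xi> = S" using e by blast
    obtain C where C: "club C" "UNIV - (\<Union>\<delta>\<in>C. {\<delta>..<G S \<delta>}) \<in> fil (p \<xi>)"
      using p(3)[of \<xi>] \<xi>(2) unfolding task_def by blast
    then have "UNIV - (\<Union>\<delta>\<in>C. {\<delta>..<ord_add \<delta> (f \<delta>)}) \<in> D" using \<xi>(1) S unfolding D by auto
    then show ?thesis using C(1) D_disjoint by blast
  qed
  ultimately have "weakly_reasonable D"
    unfolding weakly_reasonable_def uniform_ultrafilter_def by blast
  moreover have False if q: "q \<in> Q_zero F_ult" "fil q \<subseteq> D" for q
  proof -
    obtain S where S: "Q S = q" using Q q(1) by blast
    obtain \<xi> where \<xi>: "\<xi> \<in> Field ?R" "e \<xi> = S" using e by blast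
    obtain B where B: "B \<in> fil q" "UNIV - B \<in> fil (p \<xi>)"
      using p(3)[of \<xi>] \<xi>(2) S q(1) unfolding task_def by blast
    have "B \<in> D" using B(1) q(2) by blast
    moreover have "UNIV - B \<in> D" using B(2) \<xi>(1) unfolding D by blast
    ultimately show False by (rule D_disjoint)
  qed
  moreover have "p \<xi> \<in> Q_zero F_unu" for \<xi> by (rule goodQ_mem_Q_zero[OF p(1)])
  moreover have "p \<xi> \<le>\<^sup>* p \<zeta>" if "(\<xi>, \<zeta>) \<in> ?R" for \<xi> \<zeta>
    unfolding le_star_def by (rule mono[OF that])
  ultimately show ?thesis unfolding D_def by (intro exI[of _ p]) blast
qed

end
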